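(* Let $m\ge1$ be an integer, $\lambda,\mu\in\mathbb{R}$ and $\delta=\mu-\lambda$. If $(m+1)\delta-m\notin\{1,2,3,\dots\}$, then there exists a unique $s\ell_{m+1}$-equivariant linear bijection $\sigma^{\lambda\mu}:\mathcal{D}_{\lambda\mu}(\mathbb{R}^m)\to\mathcal{S}_\delta(\mathbb{R}^m)$ such that, for each $k\in\mathbb{N}$ and each $A\in\mathcal{D}^k_{\lambda\mu}(\mathbb{R}^m)$, the term of highest order of $\sigma^{\lambda\mu}(A)$ is the symbol $\sigma(A)$ of $A$ (that is, $\sigma^{\lambda\mu}(A)\in\bigoplus_{0\le\ell\le k}\mathcal{S}^\ell_\delta(\mathbb{R}^m)$ and its component in $\mathcal{S}^k_\delta(\mathbb{R}^m)$ is $\sigma(A)$).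
   Context: $s\ell_{m+1}$ denotes the Lie subalgebra of the Lie algebra $Vect(\mathbb{R}^m)$ of smooth vector fields on $\mathbb{R}^m$ spanned by $\partial_i$, $x^j\partial_i$ and $x^jE$ ($1\le i,j\le m$), where $E=\sum_i x^i\partial_i$; it is isomorphic to $s\ell(m+1,\mathbb{R})$. The space of scalar $\lambda$-densities on $\mathbb{R}^m$ is identified with $C_\infty(\mathbb{R}^m)$ with Lie derivative $L^\lambda_Xf=X.f+\lambda\,\mathrm{tr}(DX)f$, where $X.f=\sum_iX^i\partial_if$ and $DX=(\partial_jX^i)$. $\mathcal{D}^k_{\lambda\mu}(\mathbb{R}^m)$ is the space of linear differential operators of order $\le k$ from $\lambda$-densities to $\mu$-densities and $\mathcal{D}_{\lambda\mu}(\mathbb{R}^m)=\bigcup_k\mathcal{D}^k_{\lambda\mu}(\mathbb{R}^m)$, with $X$ acting by $A\mapsto L^\mu_X\circ A-A\circ L^\lambda_X$. $\mathcal{S}^k_\delta(\mathbb{R}^m)$ is the space of smooth symmetric $k$-contravariant tensor fields on $\mathbb{R}^m$ with values in the $\delta$-densities. It is identified with $C_\infty(\mathbb{R}^m,\vee^k\mathbb{R}^m)$, with Lie derivative $L_XP=X.P-\rho(DX)P+\delta\,\mathrm{tr}(DX)P$, where $\rho$ is the natural representation of $g\ell(m,\mathbb{R})$ on $\vee^k\mathbb{R}^m$. $\mathcal{S}_\delta(\mathbb{R}^m)=\bigoplus_{k\ge0}\mathcal{S}^k_\delta(\mathbb{R}^m)$. The symbol map $\sigma:\mathcal{D}^k_{\lambda\mu}(\mathbb{R}^m)\to\mathcal{S}^k_\delta(\mathbb{R}^m)$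 is $\sigma(\sum_{|\alpha|\le k}a_\alpha\partial^\alpha)(\xi)=\sum_{|\alpha|=k}a_\alpha\xi^\alpha$, viewing elements of $\vee^k\mathbb{R}^m$ as homogeneous polynomials of degree $k$ in $\xi\in\mathbb{R}^{m*}$. A linear map is $s\ell_{m+1}$-equivariant if it commutes with the actions of all $X\in s\ell_{m+1}$. *)

theory Defs
  imports "HOL-Analysis.Analysis"
begin

type_synonym 'n scalar_fn = "real^'n \<Rightarrow> real"
type_synonym 'n vec_field = "real^'n \<Rightarrow> real^'n"
type_synonym 'n operator = "'n scalar_fn \<Rightarrow> 'n scalar_fn"

definition pd :: "'n::finite \<Rightarrow> 'n scalar_fn \<Rightarrow> 'n scalar_fn"
  where "pd i f x = deriv (\<lambda>t. f (x + t *\<^sub>R axis i 1)) 0"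

primrec is_Ck :: "nat \<Rightarrow> ('n::finite) scalar_fn \<Rightarrow> bool"
  where
    "is_Ck 0 f \<longleftrightarrow> continuous_on UNIV f"
  | "is_Ck (Suc k) f \<longleftrightarrow> f differentiable_on UNIV \<and> (\<forall>i. is_Ck k (pd i f))"

definition C_inf :: "('n::finite) scalar_fn set"
  where "C_inf = {f. \<forall>k. is_Ck k f}"

definition mi_degree :: "('n::finite \<Rightarrow> nat) \<Rightarrow> nat"
  where "mi_degree \<alpha> = (\<Sum>i\<in>UNIV. \<alpha> i)"

lemma finite_mi_degree_le: "finite {\<alpha> :: 'n::finite \<Rightarrow> nat. mi_degree \<alpha> \<le> k}"
proof (rule finite_subset)
  show "{\<alpha> :: 'n \<Rightarrow> nat. mi_degree \<alpha> \<le> k} \<subseteq> (UNIV :: 'n set) \<rightarrow>\<^sub>E {..k}"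
  proof
    fix \<alpha> :: "'n \<Rightarrow> nat"
    assume "\<alpha> \<in> {\<alpha>. mi_degree \<alpha> \<le> k}"
    moreover have "\<alpha> i \<le> mi_degree \<alpha>" for i
      unfolding mi_degree_def by (rule member_le_sum) simp_all
    ultimately have "\<alpha> i \<le> k" for i
      using order_trans by blast
    then show "\<alpha> \<in> (UNIV :: 'n set) \<rightarrow>\<^sub>E {..k}"
      by (simp add: PiE_iff)
  qed
  show "finite ((UNIV :: 'n set) \<rightarrow>\<^sub>E {..k})"
    by (rule finite_PiE) simp_all
qed

(* The index type carries no order, so the composite of partial derivatives is taken along
   some word containing each index i exactly \<alpha> i times; on smooth functions partial
   derivatives commute and the choice is immaterial. *)
definition pd_multi :: "('n::finite \<Rightarrow> nat) \<Rightarrow> 'n scalar_fn \<Rightarrow> 'n scalar_fn"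
  where "pd_multi \<alpha> f = foldr pd (SOME w. \<forall>i. count_list w i = \<alpha> i) f"

definition monomial :: "('n::finite \<Rightarrow> nat) \<Rightarrow> real^'n \<Rightarrow> real"
  where "monomial \<alpha> \<xi> = (\<Prod>i\<in>UNIV. (\<xi> $ i) ^ \<alpha> i)"

definition dir_deriv :: "('n::finite) vec_field \<Rightarrow> 'n scalar_fn \<Rightarrow> 'n scalar_fn"
  where "dir_deriv X f x = (\<Sum>i\<in>UNIV. X x $ i * pd i f x)"

definition DX :: "('n::finite) vec_field \<Rightarrow> real^'n \<Rightarrow> real^'n^'n"
  where "DX X x = (\<chi> i j. pd j (\<lambda>y. X y $ i) x)"

definition const_field :: "'n::finite \<Rightarrow> 'n vec_field"
  where "const_field i x = axis i 1"

definition linear_field :: "'n::finite \<Rightarrow> 'n \<Rightarrow> 'n vec_field"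
  where "linear_field j i x = (x $ j) *\<^sub>R const_field i x"

definition euler_field :: "('n::finite) vec_field"
  where "euler_field x = (\<Sum>i\<in>UNIV. (x $ i) *\<^sub>R const_field i x)"

definition quadratic_field :: "'n::finite \<Rightarrow> 'n vec_field"
  where "quadratic_field j x = (x $ j) *\<^sub>R euler_field x"

definition sl :: "('n::finite) vec_field set"
  where "sl = {X. \<exists>c a b. X = (\<lambda>x.
      (\<Sum>i\<in>UNIV. c i *\<^sub>R const_field i x)
    + (\<Sum>j\<in>UNIV. \<Sum>i\<in>UNIV. a j i *\<^sub>R linear_field j i x)
    + (\<Sum>j\<in>UNIV. b j *\<^sub>R quadratic_field j x))}"

definition lie_density :: "real \<Rightarrow> ('n::finite) vec_field \<Rightarrow> 'n operator"
  where "lie_density lam X f x = dir_deriv X f x + lam * trace (DX X x) * f x"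

(* The domain of an operator is C_inf: operators are extensional functions, with the value
   undefined outside C_inf, so that equality of operators means equality on C_inf. *)
definition diff_op :: "nat \<Rightarrow> (('n::finite \<Rightarrow> nat) \<Rightarrow> 'n scalar_fn) \<Rightarrow> 'n operator"
  where "diff_op k a =
    (\<lambda>f\<in>C_inf. \<lambda>x. \<Sum>\<alpha> | mi_degree \<alpha> \<le> k. a \<alpha> x * pd_multi \<alpha> f x)"

(* The weights of the densities enter only through the action lie_op, not through the
   underlying space of operators; likewise for symbol_space and lie_symbol below. *)
definition diff_ops_le :: "nat \<Rightarrow> ('n::finite) operator set"
  where "diff_ops_le k = {diff_op k a | a. \<forall>\<alpha>. a \<alpha> \<in> C_inf}"

definition diff_ops :: "('n::finite) operator set"
  where "diff_ops = (\<Union>k. diff_ops_le k)"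

definition op_add :: "('n::finite) operator \<Rightarrow> 'n operator \<Rightarrow> 'n operator"
  where "op_add A B = (\<lambda>f\<in>C_inf. \<lambda>x. A f x + B f x)"

definition op_scale :: "real \<Rightarrow> ('n::finite) operator \<Rightarrow> 'n operator"
  where "op_scale c A = (\<lambda>f\<in>C_inf. \<lambda>x. c * A f x)"

definition lie_op :: "real \<Rightarrow> real \<Rightarrow> ('n::finite) vec_field \<Rightarrow> 'n operator \<Rightarrow> 'n operator"
  where "lie_op lam mu X A =
    (\<lambda>f\<in>C_inf. \<lambda>x. lie_density mu X (A f) x - A (lie_density lam X f) x)"

(* A k-contravariant symmetric tensor field P is encoded by the functions \<xi> \<mapsto> P x \<xi>,
   homogeneous polynomials of degree k in the covector \<xi>.  Covectors are represented by their
   coordinates in the dual basis, the pairing with a vector v being \<xi> \<bullet> v. *)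
type_synonym 'n tensor_field = "real^'n \<Rightarrow> real^'n \<Rightarrow> real"

definition homogeneous :: "nat \<Rightarrow> (('n::finite \<Rightarrow> nat) \<Rightarrow> 'n scalar_fn) \<Rightarrow> 'n tensor_field"
  where "homogeneous k a x \<xi> = (\<Sum>\<alpha> | mi_degree \<alpha> = k. a \<alpha> x * monomial \<alpha> \<xi>)"

definition symbols_deg :: "nat \<Rightarrow> ('n::finite) tensor_field set"
  where "symbols_deg k = {homogeneous k a | a. \<forall>\<alpha>. a \<alpha> \<in> C_inf}"

(* The direct sum of the symbols_deg k: S k is the component of degree k of S. *)
definition symbol_space :: "(nat \<Rightarrow> ('n::finite) tensor_field) set"
  where "symbol_space =
    {S. (\<forall>k. S k \<in> symbols_deg k) \<and> finite {k. S k \<noteq> (\<lambda>x \<xi>. 0)}}"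

(* The natural representation of gl(m): on degree 1 it is v \<mapsto> a *v v, extended to polynomials
   in \<xi> as a derivation (see rho_prod). *)
definition rho :: "real^'n^'n \<Rightarrow> (real^'n \<Rightarrow> real) \<Rightarrow> (real^'n::finite \<Rightarrow> real)"
  where "rho a p \<xi> = (\<Sum>i\<in>UNIV. \<Sum>j\<in>UNIV. a $ i $ j * (\<xi> $ i) * pd j p \<xi>)"

lemma pd_prod_inner:
  fixes v :: "nat \<Rightarrow> real^'n::finite"
  shows "pd j (\<lambda>\<xi>. \<Prod>l<k. \<xi> \<bullet> v l) \<xi> = (\<Sum>l<k. (v l $ j) * (\<Prod>r\<in>{..<k} - {l}. \<xi> \<bullet> v r))"
proof -
  have 1: "((\<lambda>t. (\<xi> + t *\<^sub>R axis j 1) \<bullet> v l) has_field_derivative v l $ j) (at 0)" for l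
    unfolding inner_add_left inner_scaleR_left inner_axis'
    by (auto intro!: derivative_eq_intros)
  have "((\<lambda>t. \<Prod>l<k. (\<xi> + t *\<^sub>R axis j 1) \<bullet> v l) has_field_derivative
     (\<Sum>l<k. (v l $ j) * (\<Prod>r\<in>{..<k} - {l}. (\<xi> + 0 *\<^sub>R axis j 1) \<bullet> v r))) (at 0)"
    by (rule has_field_derivative_prod) (rule 1)
  then show ?thesis
    unfolding pd_def by (simp add: DERIV_imp_deriv)
qed

lemma rho_prod:
  fixes v :: "nat \<Rightarrow> real^'n::finite"
  shows "rho a (\<lambda>\<xi>. \<Prod>l<k. \<xi> \<bullet> v l) \<xi>
    = (\<Sum>l<k. (\<xi> \<bullet> (a *v v l)) * (\<Prod>r\<in>{..<k} - {l}. \<xi> \<bullet> v r))"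
proof -
  let ?Q = "\<lambda>l. \<Prod>r\<in>{..<k} - {l}. \<xi> \<bullet> v r"
  have "rho a (\<lambda>\<xi>. \<Prod>l<k. \<xi> \<bullet> v l) \<xi>
    = (\<Sum>i\<in>UNIV. \<Sum>j\<in>UNIV. \<Sum>l<k. a $ i $ j * (\<xi> $ i) * (v l $ j) * ?Q l)"
    unfolding rho_def pd_prod_inner by (simp add: sum_distrib_left mult.assoc)
  also have "\<dots> = (\<Sum>l<k. \<Sum>i\<in>UNIV. \<Sum>j\<in>UNIV. a $ i $ j * (\<xi> $ i) * (v l $ j) * ?Q l)"
    by (subst (2) sum.swap, subst sum.swap) simp
  also have "\<dots> = (\<Sum>l<k. (\<xi> \<bullet> (a *v v l)) * ?Q l)"
    by (simp add: inner_vec_def matrix_vector_mult_def sum_distrib_left sum_distrib_right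
        mult_ac)
  finally show ?thesis .
qed

definition lie_tensor :: "real \<Rightarrow> ('n::finite) vec_field \<Rightarrow> 'n tensor_field \<Rightarrow> 'n tensor_field"
  where "lie_tensor \<delta> X P x \<xi> =
    dir_deriv X (\<lambda>y. P y \<xi>) x - rho (DX X x) (P x) \<xi> + \<delta> * trace (DX X x) * P x \<xi>"

definition lie_symbol ::
    "real \<Rightarrow> ('n::finite) vec_field \<Rightarrow> (nat \<Rightarrow> 'n tensor_field) \<Rightarrow> (nat \<Rightarrow> 'n tensor_field)"
  where "lie_symbol \<delta> X S k = lie_tensor \<delta> X (S k)"

(* Meaningful for A in diff_ops_le k; the description is then proper because an operator
   on C_inf determines its coefficients. *)
definition symbol_map :: "nat \<Rightarrow> ('n::finite) operator \<Rightarrow> 'n tensor_field"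
  where "symbol_map k A =
    (THE P. \<exists>a. (\<forall>\<alpha>. a \<alpha> \<in> C_inf) \<and> A = diff_op k a \<and> P = homogeneous k a)"

definition linear_on_ops :: "(('n::finite) operator \<Rightarrow> nat \<Rightarrow> 'n tensor_field) \<Rightarrow> bool"
  where "linear_on_ops \<sigma> \<longleftrightarrow>
    (\<forall>A\<in>diff_ops. \<forall>B\<in>diff_ops. \<sigma> (op_add A B) = (\<lambda>k x \<xi>. \<sigma> A k x \<xi> + \<sigma> B k x \<xi>)) \<and>
    (\<forall>c. \<forall>A\<in>diff_ops. \<sigma> (op_scale c A) = (\<lambda>k x \<xi>. c * \<sigma> A k x \<xi>))"

definition sl_equivariant ::
    "real \<Rightarrow> real \<Rightarrow> real \<Rightarrow> (('n::finite) operator \<Rightarrow> nat \<Rightarrow> 'n tensor_field) \<Rightarrow> bool"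
  where "sl_equivariant lam mu \<delta> \<sigma> \<longleftrightarrow>
    (\<forall>X\<in>sl. \<forall>A\<in>diff_ops. \<sigma> (lie_op lam mu X A) = lie_symbol \<delta> X (\<sigma> A))"

end

theory Submission
  imports Defs
begin

text \<open>Writing derivatives to the right identifies operators and tensor fields with the same space of
  total symbols. Under this identification the two actions of sl(m+1) agree on the affine fields,
  and along the quadratic field j they differ by (E + lam (m + 1)) \<partial>/\<partial>\<xi>_j, where E is the Euler
  operator in \<xi>. The divergence D = \<Sum>i. \<partial>/\<partial>x_i \<partial>/\<partial>\<xi>_i commutes with the affine fields and its
  commutators with the quadratic ones are again multiples of \<partial>/\<partial>\<xi>_j on each degree, so a series
  \<Sum>r. e r D^r with e r depending on the degree is equivariant as soon as e satisfies a two-term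
  recursion; its denominators are nonzero multiples of \<theta> - n with n \<ge> 1 and \<theta> = (m + 1) \<delta> - m. The series is
  unitriangular for the degree, hence bijective. For uniqueness, two such maps differ by an
  equivariant map of tensor fields which lowers the degree and commutes with the Casimir element;
  the Casimir acts by distinct scalars on distinct degrees, so this map vanishes, without any
  locality assumption.\<close>

section \<open>Smooth functions and multi-indices\<close>

text \<open>The discrepancy along a quadratic field has two sources: its second derivatives, seen
  when two coordinates are moved past the derivatives of the operator, and its nonconstant
  divergence (m + 1) x_j, which is moved past them with the factor lam. Affine fields have neither.

  Existence and uniqueness meet the same obstruction. The factor (s + 1) (\<theta> - 2 l - (s + 1))
  inverted by the recursion is minus one half of the difference of the Casimir scalars in degrees l
  + s + 1 and l. So a single hypothesis on \<theta> serves both, with n the sum of two distinct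
  degrees.

  A candidate map is only known to be linear on an infinite-dimensional function space, so no
  coefficient formula may be assumed for it. This is why the Casimir element is written out as a
  polynomial in the generators: commuting with the generators then passes to it by linearity alone,
  and the Weyl algebra relations reduce it to a function of the degree.\<close>

lemma C_infD:
  assumes "f \<in> C_inf"
  shows C_inf_differentiable: "f differentiable_on UNIV"
    and C_inf_pd: "pd i f \<in> C_inf"
proof -
  have "is_Ck (Suc k) f" for k
    using assms unfolding C_inf_def by blast
  then show "f differentiable_on UNIV" "pd i f \<in> C_inf"
    unfolding C_inf_def by auto
qed

lemma C_inf_continuous: "f \<in> C_inf \<Longrightarrow> continuous_on UNIV f"
  using C_inf_differentiable differentiable_imp_continuous_on by blast

text \<open>\<open>pd\<close> is a value of \<open>deriv\<close>, which carries no information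
  unless the derivative exists. Total differentiability supplies it at every point of the line, as
  the mean value theorem requires.\<close>

lemma DERIV_pd_along:
  assumes "f differentiable_on UNIV"
  shows "((\<lambda>t. f (x + t *\<^sub>R axis i 1)) has_real_derivative pd i f (x + s *\<^sub>R axis i 1)) (at s)"
proof -
  obtain f' where f': "(f has_derivative f') (at (x + s *\<^sub>R axis i 1))"
    using assms unfolding differentiable_on_def differentiable_def by auto
  have D: "((\<lambda>t. f (x + t *\<^sub>R axis i 1)) has_real_derivative f' (axis i 1)) (at s)"
    if "(f has_derivative f') (at (x + s *\<^sub>R axis i 1))" for x s
  proof -
    have "((\<lambda>t. x + t *\<^sub>R axis i 1) has_derivative (\<lambda>t. t *\<^sub>R axis i 1)) (at s)"
      by (auto intro!: derivative_eq_intros)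
    from has_derivative_compose[OF this that]
    have *: "((\<lambda>t. f (x + t *\<^sub>R axis i 1)) has_derivative (\<lambda>t. f' (t *\<^sub>R axis i 1))) (at s)" .
    have "linear f'"
      using that has_derivative_linear by blast
    then have "f' (t *\<^sub>R axis i 1) = f' (axis i 1) * t" for t
      by (simp add: linear_cmul)
    then show ?thesis
      using * by (simp add: has_field_derivative_def)
  qed
  have "pd i f (x + s *\<^sub>R axis i 1) = f' (axis i 1)"
    unfolding pd_def using D[of "x + s *\<^sub>R axis i 1" 0] f' by (simp add: DERIV_imp_deriv)
  then show ?thesis
    using D[OF f'] by simp
qed

lemma DERIV_pd:
  assumes "f differentiable_on UNIV"
  shows "((\<lambda>t. f (x + t *\<^sub>R axis i 1)) has_real_derivative pd i f x) (at 0)"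
  using DERIV_pd_along[OF assms, of x i 0] by simp

lemma pd_eqI:
  assumes "((\<lambda>t. f (x + t *\<^sub>R axis i 1)) has_real_derivative D) (at 0)"
  shows "pd i f x = D"
  using assms unfolding pd_def by (rule DERIV_imp_deriv)

lemma pd_const [simp]: "pd i (\<lambda>x. c) = (\<lambda>x. 0)"
  by (rule ext, rule pd_eqI) simp

lemma pd_component [simp]: "pd i (\<lambda>x. x $ j) = (\<lambda>x. if i = j then 1 else 0)"
  by (rule ext, rule pd_eqI) (auto intro!: derivative_eq_intros simp: axis_def)

lemma pd_add:
  assumes "f differentiable_on UNIV" "g differentiable_on UNIV"
  shows "pd i (\<lambda>x. f x + g x) = (\<lambda>x. pd i f x + pd i g x)"
  by (rule ext, rule pd_eqI) (intro DERIV_add DERIV_pd assms)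

lemma pd_mult:
  assumes "f differentiable_on UNIV" "g differentiable_on UNIV"
  shows "pd i (\<lambda>x. f x * g x) = (\<lambda>x. pd i f x * g x + f x * pd i g x)"
  by (rule ext, rule pd_eqI)
    (use DERIV_mult[OF DERIV_pd[OF assms(1)] DERIV_pd[OF assms(2)]] in \<open>simp add: mult.commute\<close>)

lemma pd_cmult:
  assumes "f differentiable_on UNIV"
  shows "pd i (\<lambda>x. c * f x) = (\<lambda>x. c * pd i f x)"
  using pd_mult[of "\<lambda>x. c" f i] assms by simp

lemma is_Ck_Suc_imp: "is_Ck (Suc k) f \<Longrightarrow> is_Ck k f"
  by (induction k arbitrary: f) (auto simp: differentiable_imp_continuous_on)

lemma is_Ck_add: "is_Ck k f \<Longrightarrow> is_Ck k g \<Longrightarrow> is_Ck k (\<lambda>x. f x + g x)"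
  by (induction k arbitrary: f g)
    (auto simp: pd_add intro!: continuous_intros)

lemma is_Ck_mult: "is_Ck k f \<Longrightarrow> is_Ck k g \<Longrightarrow> is_Ck k (\<lambda>x. f x * g x)"
proof (induction k arbitrary: f g)
  case 0
  then show ?case by (auto intro!: continuous_intros)
next
  case (Suc k)
  then have "is_Ck k f" "is_Ck k g"
    using is_Ck_Suc_imp by blast+
  with Suc show ?case
    by (auto simp: pd_mult intro!: is_Ck_add differentiable_on_mult)
qed

lemma C_inf_const [simp]: "(\<lambda>x :: real^'n::finite. c) \<in> C_inf"
proof -
  have "is_Ck k (\<lambda>x :: real^'n. c)" for k and c :: real
    by (induction k arbitrary: c) auto
  then show ?thesis by (simp add: C_inf_def)
qed

lemma C_inf_component [simp]: "(\<lambda>x :: real^'n::finite. x $ j) \<in> C_inf"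
proof -
  have "is_Ck k (\<lambda>x :: real^'n. x $ j)" for k
  proof (cases k)
    case (Suc l)
    have "is_Ck l (\<lambda>x :: real^'n. if i = j then 1 else 0 :: real)" for i
      using C_inf_const[of "if i = j then 1 else 0"] unfolding C_inf_def by blast
    moreover have "(\<lambda>x :: real^'n. x $ j) differentiable_on UNIV"
      by (intro bounded_linear_imp_differentiable_on bounded_linear_vec_nth)
    ultimately show ?thesis by (simp add: Suc split del: if_split)
  qed (auto intro!: continuous_intros)
  then show ?thesis by (simp add: C_inf_def)
qed

lemma C_inf_add [intro]: "f \<in> C_inf \<Longrightarrow> g \<in> C_inf \<Longrightarrow> (\<lambda>x. f x + g x) \<in> C_inf"
  by (auto simp: C_inf_def intro: is_Ck_add)

lemma C_inf_mult [intro]: "f \<in> C_inf \<Longrightarrow> g \<in> C_inf \<Longrightarrow> (\<lambda>x. f x * g x) \<in> C_inf"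
  by (auto simp: C_inf_def intro: is_Ck_mult)

lemma C_inf_cmult [intro]: "f \<in> C_inf \<Longrightarrow> (\<lambda>x. c * f x) \<in> C_inf"
  by (rule C_inf_mult) auto

lemma C_inf_sum [intro]: "(\<And>i. i \<in> I \<Longrightarrow> f i \<in> C_inf) \<Longrightarrow> (\<lambda>x. \<Sum>i\<in>I. f i x) \<in> C_inf"
  by (induction I rule: infinite_finite_induct) auto

lemma pd_add_C_inf:
  "f \<in> C_inf \<Longrightarrow> g \<in> C_inf \<Longrightarrow> pd i (\<lambda>x. f x + g x) = (\<lambda>x. pd i f x + pd i g x)"
  by (intro pd_add C_inf_differentiable)

lemma pd_mult_C_inf:
  "f \<in> C_inf \<Longrightarrow> g \<in> C_inf \<Longrightarrow> pd i (\<lambda>x. f x * g x) = (\<lambda>x. pd i f x * g x + f x * pd i g x)"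
  by (intro pd_mult C_inf_differentiable)

lemma pd_cmult_C_inf: "f \<in> C_inf \<Longrightarrow> pd i (\<lambda>x. c * f x) = (\<lambda>x. c * pd i f x)"
  by (intro pd_cmult C_inf_differentiable)

lemma pd_sum_C_inf:
  "(\<And>l. l \<in> I \<Longrightarrow> f l \<in> C_inf) \<Longrightarrow> pd i (\<lambda>x. \<Sum>l\<in>I. f l x) = (\<lambda>x. \<Sum>l\<in>I. pd i (f l) x)"
  by (induction I rule: infinite_finite_induct) (auto simp: pd_add_C_inf C_inf_sum)

section \<open>Symmetry of second partial derivatives\<close>

lemma second_difference:
  assumes f: "f \<in> C_inf" and h: "h > 0"
  obtains s t where "0 < s" "s < h" "0 < t" "t < h"
    "f (x + h *\<^sub>R axis i 1 + h *\<^sub>R axis j 1) - f (x + h *\<^sub>R axis i 1) - f (x + h *\<^sub>R axis j 1) + f x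
      = h * h * pd j (pd i f) (x + s *\<^sub>R axis i 1 + t *\<^sub>R axis j 1)"
proof -
  note df = C_inf_differentiable[OF f] and dpf = C_inf_differentiable[OF C_inf_pd[OF f]]
  define F where "F s = f ((x + h *\<^sub>R axis j 1) + s *\<^sub>R axis i 1) - f (x + s *\<^sub>R axis i 1)" for s
  have "DERIV F s :> pd i f ((x + h *\<^sub>R axis j 1) + s *\<^sub>R axis i 1) - pd i f (x + s *\<^sub>R axis i 1)" for s
    unfolding F_def by (intro DERIV_diff DERIV_pd_along df)
  from MVT2[of 0 h F, OF h this] obtain s where s: "0 < s" "s < h"
    "F h - F 0 = (h - 0) * (pd i f ((x + h *\<^sub>R axis j 1) + s *\<^sub>R axis i 1) - pd i f (x + s *\<^sub>R axis i 1))"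
    by blast
  define G where "G t = pd i f ((x + s *\<^sub>R axis i 1) + t *\<^sub>R axis j 1)" for t
  have "DERIV G t :> pd j (pd i f) ((x + s *\<^sub>R axis i 1) + t *\<^sub>R axis j 1)" for t
    unfolding G_def by (intro DERIV_pd_along dpf)
  from MVT2[of 0 h G, OF h this] obtain t where t: "0 < t" "t < h"
    "G h - G 0 = (h - 0) * pd j (pd i f) ((x + s *\<^sub>R axis i 1) + t *\<^sub>R axis j 1)"
    by blast
  show ?thesis
    by (rule that[OF s(1,2) t(1,2)]) (use s(3) t(3) in \<open>simp add: F_def G_def algebra_simps\<close>)
qed

text \<open>The second difference is symmetric in i and j, so for every h the two mixed derivatives
  agree at a pair of points within distance of order h from x. Continuity gives equality at x as h
  tends to 0.\<close>

lemma pd_commute: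
  assumes f: "f \<in> C_inf"
  shows "pd i (pd j f) = pd j (pd i f)"
proof
  fix x
  define S where "S h s t = (0 < s \<and> s < h \<and> 0 < t \<and> t < h)" for h s t :: real
  define h where "h n = inverse (real (Suc n))" for n
  have "\<exists>s t s' t'. S (h n) s t \<and> S (h n) s' t' \<and>
    pd j (pd i f) (x + s *\<^sub>R axis i 1 + t *\<^sub>R axis j 1) = pd i (pd j f) (x + s' *\<^sub>R axis j 1 + t' *\<^sub>R axis i 1)" for n
  proof -
    have h: "h n > 0" by (simp add: h_def)
    obtain s t where 1: "0 < s" "s < h n" "0 < t" "t < h n"
      "f (x + h n *\<^sub>R axis i 1 + h n *\<^sub>R axis j 1) - f (x + h n *\<^sub>R axis i 1) - f (x + h n *\<^sub>R axis j 1) + f x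
      = h n * h n * pd j (pd i f) (x + s *\<^sub>R axis i 1 + t *\<^sub>R axis j 1)"
      by (rule second_difference[OF f h])
    obtain s' t' where 2: "0 < s'" "s' < h n" "0 < t'" "t' < h n"
      "f (x + h n *\<^sub>R axis j 1 + h n *\<^sub>R axis i 1) - f (x + h n *\<^sub>R axis j 1) - f (x + h n *\<^sub>R axis i 1) + f x
      = h n * h n * pd i (pd j f) (x + s' *\<^sub>R axis j 1 + t' *\<^sub>R axis i 1)"
      by (rule second_difference[OF f h])
    have comm: "x + h n *\<^sub>R axis j 1 + h n *\<^sub>R axis i 1 = x + h n *\<^sub>R axis i 1 + h n *\<^sub>R axis j 1"
      by (simp add: algebra_simps)
    have "h n * h n * pd j (pd i f) (x + s *\<^sub>R axis i 1 + t *\<^sub>R axis j 1)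
        = h n * h n * pd i (pd j f) (x + s' *\<^sub>R axis j 1 + t' *\<^sub>R axis i 1)"
      using 1(5) 2(5)[unfolded comm] by linarith
    then have "pd j (pd i f) (x + s *\<^sub>R axis i 1 + t *\<^sub>R axis j 1) = pd i (pd j f) (x + s' *\<^sub>R axis j 1 + t' *\<^sub>R axis i 1)"
      using h by simp
    then show ?thesis
      using 1 2 unfolding S_def by blast
  qed
  then obtain s t s' t' where st: "S (h n) (s n) (t n)" "S (h n) (s' n) (t' n)"
    and eq: "pd j (pd i f) (x + s n *\<^sub>R axis i 1 + t n *\<^sub>R axis j 1)
      = pd i (pd j f) (x + s' n *\<^sub>R axis j 1 + t' n *\<^sub>R axis i 1)" for n
    by metis
  have h0: "h \<longlonglongrightarrow> 0"
    unfolding h_def by (rule LIMSEQ_inverse_real_of_nat)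
  have lim0: "s \<longlonglongrightarrow> 0" "t \<longlonglongrightarrow> 0" "s' \<longlonglongrightarrow> 0" "t' \<longlonglongrightarrow> 0"
    using st unfolding S_def
    by (auto intro!: real_tendsto_sandwich[OF _ _ tendsto_const h0] always_eventually less_imp_le)
  have "(\<lambda>n. x + s n *\<^sub>R axis i 1 + t n *\<^sub>R axis j 1) \<longlonglongrightarrow> x + 0 *\<^sub>R axis i 1 + 0 *\<^sub>R axis j 1"
    "(\<lambda>n. x + s' n *\<^sub>R axis j 1 + t' n *\<^sub>R axis i 1) \<longlonglongrightarrow> x + 0 *\<^sub>R axis j 1 + 0 *\<^sub>R axis i 1"
    by (intro tendsto_intros lim0)+
  then have l: "(\<lambda>n. x + s n *\<^sub>R axis i 1 + t n *\<^sub>R axis j 1) \<longlonglongrightarrow> x"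
    "(\<lambda>n. x + s' n *\<^sub>R axis j 1 + t' n *\<^sub>R axis i 1) \<longlonglongrightarrow> x"
    by simp_all
  have c: "isCont (pd j (pd i f)) x" "isCont (pd i (pd j f)) x"
    using C_inf_continuous[OF C_inf_pd[OF C_inf_pd[OF f]]]
    by (auto simp: continuous_on_eq_continuous_at)
  show "pd i (pd j f) x = pd j (pd i f) x"
    using isCont_tendsto_compose[OF c(1) l(1)] isCont_tendsto_compose[OF c(2) l(2)]
    unfolding eq by (rule LIMSEQ_unique[rotated])
qed

section \<open>Iterated derivatives and multi-indices\<close>

lemma C_inf_foldr_pd: "f \<in> C_inf \<Longrightarrow> foldr pd w f \<in> C_inf"
  by (induction w) (auto intro: C_inf_pd)

lemma foldr_pd_pd: "f \<in> C_inf \<Longrightarrow> foldr pd w (pd i f) = pd i (foldr pd w f)"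
  by (induction w) (auto simp: pd_commute C_inf_foldr_pd)

lemma foldr_pd_remove1:
  assumes "f \<in> C_inf" "i \<in> set w"
  shows "foldr pd w f = pd i (foldr pd (remove1 i w) f)"
  using assms(2)
  by (induction w) (auto simp: pd_commute C_inf_foldr_pd assms(1))

text \<open>Since derivatives commute, only the letter counts matter; this makes the word picked by
  \<open>SOME\<close> in \<open>pd_multi\<close> irrelevant.\<close>

lemma foldr_pd_cong:
  assumes f: "f \<in> C_inf" and "\<And>i. count_list v i = count_list w i"
  shows "foldr pd v f = foldr pd w f"
  using assms(2)
proof (induction v arbitrary: w)
  case Nil
  then have "w = []"
    by (metis count_list.simps(1) count_list_0_iff ex_in_conv set_empty)
  then show ?case by simp
next
  case (Cons i v)
  have i: "i \<in> set w"
    using Cons.prems[of i] count_notin[of i w] by fastforce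
  have rm: "count_list w l = count_list (remove1 i w) l + (if l = i then 1 else 0)" for l
    using i by (induction w) auto
  have "foldr pd v f = foldr pd (remove1 i w) f"
  proof (rule Cons.IH)
    show "count_list v l = count_list (remove1 i w) l" for l
      using Cons.prems[of l] unfolding rm[of l] by (cases "l = i") simp_all
  qed
  then show ?case
    using foldr_pd_remove1[OF f i] by simp
qed

lemma ex_word: "\<exists>w. \<forall>i. count_list w i = (\<alpha> :: 'n::finite \<Rightarrow> nat) i"
proof (induction "mi_degree \<alpha>" arbitrary: \<alpha>)
  case 0
  then have "\<forall>i. count_list [] i = \<alpha> i"
    by (simp add: mi_degree_def)
  then show ?case by blast
next
  case (Suc n)
  then obtain i where i: "\<alpha> i > 0"
    unfolding mi_degree_def by (metis (no_types, lifting) nat.distinct(1) neq0_conv sum.neutral)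
  let ?\<beta> = "\<alpha>(i := \<alpha> i - 1)"
  have "mi_degree \<alpha> = \<alpha> i + (\<Sum>l\<in>UNIV - {i}. \<alpha> l)" "mi_degree ?\<beta> = \<alpha> i - 1 + (\<Sum>l\<in>UNIV - {i}. \<alpha> l)"
    unfolding mi_degree_def by (simp_all add: sum.remove[of UNIV i])
  then have "n = mi_degree ?\<beta>"
    using Suc.hyps(2) i by linarith
  from Suc.hyps(1)[OF this] obtain w where "\<forall>l. count_list w l = ?\<beta> l" ..
  then have "\<forall>l. count_list (i # w) l = \<alpha> l"
    using i by auto
  then show ?case by blast
qed

definition mi_inc :: "'n \<Rightarrow> ('n::finite \<Rightarrow> nat) \<Rightarrow> 'n \<Rightarrow> nat"
  where "mi_inc i \<alpha> = \<alpha>(i := Suc (\<alpha> i))"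

text \<open>Truncated: \<^term>\<open>mi_dec i \<alpha>\<close> is \<alpha> itself when \<alpha> i = 0.\<close>

definition mi_dec :: "'n \<Rightarrow> ('n::finite \<Rightarrow> nat) \<Rightarrow> 'n \<Rightarrow> nat"
  where "mi_dec i \<alpha> = \<alpha>(i := \<alpha> i - 1)"

lemma mi_inc_apply: "mi_inc i \<alpha> j = (if j = i then Suc (\<alpha> j) else \<alpha> j)"
  and mi_dec_apply: "mi_dec i \<alpha> j = (if j = i then \<alpha> j - 1 else \<alpha> j)"
  by (simp_all add: mi_inc_def mi_dec_def)

lemma mi_dec_inc [simp]: "mi_dec i (mi_inc i \<alpha>) = \<alpha>"
  by (simp add: fun_eq_iff mi_inc_apply mi_dec_apply)

lemma mi_inc_dec [simp]: "\<alpha> i \<noteq> 0 \<Longrightarrow> mi_inc i (mi_dec i \<alpha>) = \<alpha>"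
  by (simp add: fun_eq_iff mi_inc_apply mi_dec_apply)

lemma mi_inc_commute: "mi_inc i (mi_inc j \<alpha>) = mi_inc j (mi_inc i \<alpha>)"
  by (simp add: fun_eq_iff mi_inc_apply)

lemma mi_inc_dec_commute: "i \<noteq> j \<Longrightarrow> mi_inc i (mi_dec j \<alpha>) = mi_dec j (mi_inc i \<alpha>)"
  by (simp add: fun_eq_iff mi_inc_apply mi_dec_apply)

lemma mi_degree_inc [simp]: "mi_degree (mi_inc i \<alpha>) = Suc (mi_degree \<alpha>)"
proof -
  have "mi_degree \<alpha> = \<alpha> i + (\<Sum>l\<in>UNIV - {i}. \<alpha> l)"
    "mi_degree (mi_inc i \<alpha>) = Suc (\<alpha> i) + (\<Sum>l\<in>UNIV - {i}. \<alpha> l)"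
    unfolding mi_degree_def mi_inc_def by (simp_all add: sum.remove[of UNIV i])
  then show ?thesis by simp
qed

lemma mi_degree_dec: "\<alpha> i \<noteq> 0 \<Longrightarrow> Suc (mi_degree (mi_dec i \<alpha>)) = mi_degree \<alpha>"
  by (metis mi_degree_inc mi_inc_dec)

lemma mi_degree_eq_0_iff [simp]: "mi_degree \<alpha> = 0 \<longleftrightarrow> \<alpha> = (\<lambda>i. 0)"
  by (auto simp: mi_degree_def)

lemma mi_neq_0E:
  assumes "\<alpha> \<noteq> (\<lambda>i. 0)"
  obtains i \<beta> where "\<alpha> = mi_inc i \<beta>"
proof -
  obtain i where "\<alpha> i \<noteq> 0"
    using assms by auto
  then have "\<alpha> = mi_inc i (mi_dec i \<alpha>)" by simp
  then show ?thesis by (rule that)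
qed

lemma mi_neq_0_of_degree_Suc: "mi_degree \<alpha> = Suc k \<Longrightarrow> \<alpha> \<noteq> (\<lambda>i. 0)"
  by (metis mi_degree_eq_0_iff nat.distinct(1))

lemma pd_multi_eq_foldr:
  assumes "f \<in> C_inf" "\<And>i. count_list w i = \<alpha> i"
  shows "pd_multi \<alpha> f = foldr pd w f"
proof -
  have "\<forall>i. count_list (SOME w. \<forall>i. count_list w i = \<alpha> i) i = \<alpha> i"
    using ex_word by (rule someI_ex)
  then show ?thesis
    unfolding pd_multi_def using assms by (intro foldr_pd_cong) auto
qed

lemma pd_multi_0 [simp]: "f \<in> C_inf \<Longrightarrow> pd_multi (\<lambda>i. 0) f = f"
  using pd_multi_eq_foldr[of f "[]" "\<lambda>i. 0"] by simp

text \<open>The extra derivative may stand outermost or innermost: the first form is for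
  differentiating the value of an operator, the second for composing an operator with a derivative
  on the right.\<close>

lemma pd_multi_inc:
  assumes "f \<in> C_inf"
  shows "pd_multi (mi_inc i \<alpha>) f = pd i (pd_multi \<alpha> f)"
    and "pd_multi (mi_inc i \<alpha>) f = pd_multi \<alpha> (pd i f)"
proof -
  obtain w where w: "\<And>i. count_list w i = \<alpha> i"
    using ex_word by metis
  have "pd_multi (mi_inc i \<alpha>) f = foldr pd (i # w) f"
    using assms w by (intro pd_multi_eq_foldr) (auto simp: mi_inc_apply)
  then show "pd_multi (mi_inc i \<alpha>) f = pd i (pd_multi \<alpha> f)"
    using pd_multi_eq_foldr[OF assms w] by simp
  then show "pd_multi (mi_inc i \<alpha>) f = pd_multi \<alpha> (pd i f)"
    using pd_multi_eq_foldr[OF assms w] pd_multi_eq_foldr[OF C_inf_pd[OF assms] w]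
      foldr_pd_pd[OF assms] by simp
qed

lemma C_inf_pd_multi: "f \<in> C_inf \<Longrightarrow> pd_multi \<alpha> f \<in> C_inf"
  using ex_word[of \<alpha>] by (metis pd_multi_eq_foldr C_inf_foldr_pd)

lemma mi_induct [case_names zero inc]:
  assumes "P (\<lambda>i. 0)" "\<And>i \<alpha>. P \<alpha> \<Longrightarrow> P (mi_inc i \<alpha>)"
  shows "P (\<alpha> :: 'n::finite \<Rightarrow> nat)"
proof (induction "mi_degree \<alpha>" arbitrary: \<alpha>)
  case 0
  then have "\<alpha> = (\<lambda>i. 0)"
    using mi_degree_eq_0_iff by metis
  then show ?case
    using assms(1) by simp
next
  case (Suc k)
  then obtain i \<beta> where "\<alpha> = mi_inc i \<beta>"
    using mi_neq_0_of_degree_Suc mi_neq_0E by metis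
  with Suc show ?case by (auto intro: assms(2))
qed

lemma pd_multi_add:
  assumes "f \<in> C_inf" "g \<in> C_inf"
  shows "pd_multi \<alpha> (\<lambda>x. f x + g x) = (\<lambda>x. pd_multi \<alpha> f x + pd_multi \<alpha> g x)"
  by (induction \<alpha> rule: mi_induct)
    (simp_all add: assms C_inf_add pd_multi_inc(1) pd_add_C_inf C_inf_pd_multi)

lemma pd_multi_cmult:
  assumes "f \<in> C_inf"
  shows "pd_multi \<alpha> (\<lambda>x. c * f x) = (\<lambda>x. c * pd_multi \<alpha> f x)"
  by (induction \<alpha> rule: mi_induct)
    (simp_all add: assms C_inf_cmult pd_multi_inc(1) pd_cmult_C_inf C_inf_pd_multi)

text \<open>A coordinate has no higher derivatives, so the Leibniz expansion stops after two terms.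
  When \<alpha> i = 0 the truncated \<open>mi_dec i \<alpha>\<close> is harmless because its factor
  vanishes.\<close>

lemma pd_multi_component_mult:
  assumes f: "f \<in> C_inf"
  shows "pd_multi \<alpha> (\<lambda>x. x $ i * f x)
    = (\<lambda>x. x $ i * pd_multi \<alpha> f x + real (\<alpha> i) * pd_multi (mi_dec i \<alpha>) f x)"
proof (induction \<alpha> rule: mi_induct)
  case zero
  then show ?case by (simp add: f C_inf_mult)
next
  case (inc j \<alpha>)
  have "pd_multi (mi_inc j \<alpha>) (\<lambda>x. x $ i * f x)
      = pd j (\<lambda>x. x $ i * pd_multi \<alpha> f x + real (\<alpha> i) * pd_multi (mi_dec i \<alpha>) f x)"
    by (simp add: f pd_multi_inc(1) C_inf_mult inc)
  also have "\<dots> = (\<lambda>x. (if i = j then 1 else 0) * pd_multi \<alpha> f x + x $ i * pd_multi (mi_inc j \<alpha>) f x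
      + real (\<alpha> i) * pd_multi (mi_inc j (mi_dec i \<alpha>)) f x)"
    by (simp add: f pd_multi_inc(1) pd_add_C_inf pd_mult_C_inf pd_cmult_C_inf C_inf_pd_multi
        C_inf_mult C_inf_cmult)
  also have "\<dots> = (\<lambda>x. x $ i * pd_multi (mi_inc j \<alpha>) f x
      + real (mi_inc j \<alpha> i) * pd_multi (mi_dec i (mi_inc j \<alpha>)) f x)"
    by (cases "i = j"; cases "\<alpha> i = 0")
      (auto simp: mi_inc_apply mi_inc_dec_commute algebra_simps)
  finally show ?case .
qed

section \<open>Total symbols\<close>

text \<open>For a finite index type this amounts to finite support. Phrased through the degree it
  matches both the finite order of an operator and the finitely many components of an element of the
  direct sum.\<close>

definition bounded_support :: "(('n::finite \<Rightarrow> nat) \<Rightarrow> 'n scalar_fn) \<Rightarrow> bool"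
  where "bounded_support a \<longleftrightarrow> (\<exists>n. \<forall>\<alpha>. n \<le> mi_degree \<alpha> \<longrightarrow> a \<alpha> = (\<lambda>x. 0))"

lemma bounded_support_mono:
  "bounded_support a \<Longrightarrow> (\<And>\<alpha>. a \<alpha> = (\<lambda>x. 0) \<Longrightarrow> b \<alpha> = (\<lambda>x. 0)) \<Longrightarrow> bounded_support b"
  unfolding bounded_support_def by metis

lemma bounded_support_zero: "bounded_support (\<lambda>\<alpha> x. 0)"
  by (simp add: bounded_support_def)

lemma bounded_support_add:
  assumes "bounded_support a" "bounded_support b"
  shows "bounded_support (\<lambda>\<alpha> x. a \<alpha> x + b \<alpha> x)"
proof -
  obtain m n where "\<And>\<alpha>. m \<le> mi_degree \<alpha> \<Longrightarrow> a \<alpha> = (\<lambda>x. 0)" "\<And>\<alpha>. n \<le> mi_degree \<alpha> \<Longrightarrow> b \<alpha> = (\<lambda>x. 0)"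
    using assms unfolding bounded_support_def by metis
  then show ?thesis
    unfolding bounded_support_def by (intro exI[of _ "max m n"]) simp
qed

text \<open>A total symbol \<Sum>\<alpha>. a \<alpha> x * \<xi>^\<alpha>, given by its coefficients. It represents at once a
  differential operator, with all derivatives to the right, and a section of the direct sum of the
  symmetric tensor fields. The operators mulx, dx, mulxi, dxi defined below generate the Weyl algebra
  in the variables x and \<xi>.\<close>

typedef 'n sym = "{a :: ('n::finite \<Rightarrow> nat) \<Rightarrow> 'n scalar_fn. (\<forall>\<alpha>. a \<alpha> \<in> C_inf) \<and> bounded_support a}"
  morphisms coef Abs_sym
  by (rule exI[of _ "\<lambda>\<alpha> x. 0"]) (simp add: bounded_support_zero)

setup_lifting type_definition_sym

lemma sym_eqI: "(\<And>\<alpha> x. coef a \<alpha> x = coef b \<alpha> x) \<Longrightarrow> a = b"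
  by (simp add: coef_inject[symmetric] fun_eq_iff)

lemma coef_C_inf [simp]: "coef a \<alpha> \<in> C_inf"
  using coef[of a] by blast

instantiation sym :: (finite) real_vector
begin

lift_definition zero_sym :: "'a sym" is "\<lambda>\<alpha> x. 0"
  by (simp add: bounded_support_zero)

lift_definition plus_sym :: "'a sym \<Rightarrow> 'a sym \<Rightarrow> 'a sym" is "\<lambda>a b \<alpha> x. a \<alpha> x + b \<alpha> x"
  by (auto intro: C_inf_add bounded_support_add)

lift_definition scaleR_sym :: "real \<Rightarrow> 'a sym \<Rightarrow> 'a sym" is "\<lambda>c a \<alpha> x. c * a \<alpha> x"
  by (auto intro: C_inf_cmult elim: bounded_support_mono)

definition uminus_sym :: "'a sym \<Rightarrow> 'a sym" where "uminus_sym a = (-1) *\<^sub>R a"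

definition minus_sym :: "'a sym \<Rightarrow> 'a sym \<Rightarrow> 'a sym" where "minus_sym a b = a + (- b)"

instance
proof
  fix a b c :: "'a sym" and r s :: real
  show "a + b + c = a + (b + c)" "a + b = b + a" "0 + a = a"
    "r *\<^sub>R (a + b) = r *\<^sub>R a + r *\<^sub>R b" "(r + s) *\<^sub>R a = r *\<^sub>R a + s *\<^sub>R a"
    "r *\<^sub>R s *\<^sub>R a = (r * s) *\<^sub>R a" "1 *\<^sub>R a = a"
    by (transfer; simp add: algebra_simps)+
  show "- a + a = 0"
    unfolding uminus_sym_def by transfer simp
  show "a - b = a + - b"
    by (rule minus_sym_def)
qed

end

lemma coef_zero [simp]: "coef 0 \<alpha> x = 0"
  and coef_add [simp]: "coef (a + b) \<alpha> x = coef a \<alpha> x + coef b \<alpha> x"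
  and coef_scaleR [simp]: "coef (c *\<^sub>R a) \<alpha> x = c * coef a \<alpha> x"
  by (transfer; simp)+

lemma coef_uminus [simp]: "coef (- a) \<alpha> x = - coef a \<alpha> x"
  by (simp only: uminus_sym_def coef_scaleR mult_minus1)

lemma coef_diff [simp]: "coef (a - b) \<alpha> x = coef a \<alpha> x - coef b \<alpha> x"
  by (simp only: minus_sym_def coef_add coef_uminus diff_conv_add_uminus)

lemma coef_sum [simp]: "coef (\<Sum>i\<in>I. a i) \<alpha> x = (\<Sum>i\<in>I. coef (a i) \<alpha> x)"
  by (induction I rule: infinite_finite_induct) auto

lemma coef_add_eq: "coef (a + b) \<alpha> = (\<lambda>x. coef a \<alpha> x + coef b \<alpha> x)"
  and coef_scaleR_eq: "coef (c *\<^sub>R a) \<alpha> = (\<lambda>x. c * coef a \<alpha> x)"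
  by (simp_all add: fun_eq_iff)

lift_definition mulx :: "'n::finite \<Rightarrow> 'n sym \<Rightarrow> 'n sym" is "\<lambda>i a \<alpha> x. x $ i * a \<alpha> x"
  by (auto intro: C_inf_mult elim: bounded_support_mono)

lift_definition dx :: "'n::finite \<Rightarrow> 'n sym \<Rightarrow> 'n sym" is "\<lambda>i a \<alpha>. pd i (a \<alpha>)"
  by (auto intro: C_inf_pd elim: bounded_support_mono)

lift_definition mulxi :: "'n::finite \<Rightarrow> 'n sym \<Rightarrow> 'n sym"
  is "\<lambda>i a \<alpha> x. if \<alpha> i = 0 then 0 else a (mi_dec i \<alpha>) x"
proof -
  fix i :: 'n and a :: "('n \<Rightarrow> nat) \<Rightarrow> 'n scalar_fn"
  assume "(\<forall>\<alpha>. a \<alpha> \<in> C_inf) \<and> bounded_support a"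
  then obtain n where a: "\<And>\<alpha>. a \<alpha> \<in> C_inf" "\<And>\<alpha>. n \<le> mi_degree \<alpha> \<Longrightarrow> a \<alpha> = (\<lambda>x. 0)"
    unfolding bounded_support_def by blast
  have "n \<le> mi_degree (mi_dec i \<alpha>)" if "Suc n \<le> mi_degree \<alpha>" "\<alpha> i \<noteq> 0" for \<alpha>
    using that mi_degree_dec[of \<alpha> i] by simp
  then have "Suc n \<le> mi_degree \<alpha> \<Longrightarrow> (\<lambda>x. if \<alpha> i = 0 then 0 else a (mi_dec i \<alpha>) x) = (\<lambda>x. 0)" for \<alpha>
    by (auto simp: a(2))
  moreover have "(\<lambda>x. if \<alpha> i = 0 then 0 else a (mi_dec i \<alpha>) x) \<in> C_inf" for \<alpha>
    using a(1) by (cases "\<alpha> i = 0") auto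
  ultimately show "(\<forall>\<alpha>. (\<lambda>x. if \<alpha> i = 0 then 0 else a (mi_dec i \<alpha>) x) \<in> C_inf) \<and>
    bounded_support (\<lambda>\<alpha> x. if \<alpha> i = 0 then 0 else a (mi_dec i \<alpha>) x)"
    unfolding bounded_support_def by blast
qed

lift_definition dxi :: "'n::finite \<Rightarrow> 'n sym \<Rightarrow> 'n sym"
  is "\<lambda>i a \<alpha> x. real (Suc (\<alpha> i)) * a (mi_inc i \<alpha>) x"
proof -
  fix i :: 'n and a :: "('n \<Rightarrow> nat) \<Rightarrow> 'n scalar_fn"
  assume "(\<forall>\<alpha>. a \<alpha> \<in> C_inf) \<and> bounded_support a"
  then obtain n where a: "\<And>\<alpha>. a \<alpha> \<in> C_inf" "\<And>\<alpha>. n \<le> mi_degree \<alpha> \<Longrightarrow> a \<alpha> = (\<lambda>x. 0)"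
    unfolding bounded_support_def by blast
  then have "n \<le> mi_degree \<alpha> \<Longrightarrow> a (mi_inc i \<alpha>) = (\<lambda>x. 0)" for \<alpha>
    by simp
  with a(1) show "(\<forall>\<alpha>. (\<lambda>x. real (Suc (\<alpha> i)) * a (mi_inc i \<alpha>) x) \<in> C_inf) \<and>
    bounded_support (\<lambda>\<alpha> x. real (Suc (\<alpha> i)) * a (mi_inc i \<alpha>) x)"
    unfolding bounded_support_def by (intro conjI exI[of _ n]) (auto intro: C_inf_cmult)
qed

text \<open>A function of the Euler operator in \<xi>. It covers the degree itself
  (\<open>wt real\<close>), coefficients that depend on the degree, and the projection onto one
  degree (an indicator), with common commutation rules.\<close>

lift_definition wt :: "(nat \<Rightarrow> real) \<Rightarrow> 'n::finite sym \<Rightarrow> 'n sym"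
  is "\<lambda>\<phi> a \<alpha> x. \<phi> (mi_degree \<alpha>) * a \<alpha> x"
  by (auto intro: C_inf_cmult elim: bounded_support_mono)

lemma coef_mulx [simp]: "coef (mulx i a) \<alpha> x = x $ i * coef a \<alpha> x"
  and coef_dx: "coef (dx i a) \<alpha> = pd i (coef a \<alpha>)"
  and coef_mulxi [simp]: "coef (mulxi i a) \<alpha> x = (if \<alpha> i = 0 then 0 else coef a (mi_dec i \<alpha>) x)"
  and coef_dxi [simp]: "coef (dxi i a) \<alpha> x = real (Suc (\<alpha> i)) * coef a (mi_inc i \<alpha>) x"
  and coef_wt [simp]: "coef (wt \<phi> a) \<alpha> x = \<phi> (mi_degree \<alpha>) * coef a \<alpha> x"
  by (transfer; simp)+

lemma coef_mulx_eq: "coef (mulx i a) \<alpha> = (\<lambda>x. x $ i * coef a \<alpha> x)"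
  and coef_mulxi_eq: "coef (mulxi i a) \<alpha> = (if \<alpha> i = 0 then (\<lambda>x. 0) else coef a (mi_dec i \<alpha>))"
  and coef_dxi_eq: "coef (dxi i a) \<alpha> = (\<lambda>x. real (Suc (\<alpha> i)) * coef a (mi_inc i \<alpha>) x)"
  and coef_wt_eq: "coef (wt \<phi> a) \<alpha> = (\<lambda>x. \<phi> (mi_degree \<alpha>) * coef a \<alpha> x)"
  by (auto simp: fun_eq_iff)

lemma linear_mulx: "linear (mulx i)"
  and linear_dx: "linear (dx i)"
  and linear_mulxi: "linear (mulxi i)"
  and linear_dxi: "linear (dxi i)"
  and linear_wt: "linear (wt \<phi>)"
  by (rule linearI; rule sym_eqI;
      simp add: coef_dx coef_add_eq coef_scaleR_eq pd_add_C_inf pd_cmult_C_inf algebra_simps)+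

lemmas sym_linear = linear_mulx linear_dx linear_mulxi linear_dxi linear_wt
lemmas sym_add = sym_linear[THEN linear_add]
lemmas sym_diff = sym_linear[THEN linear_diff]
lemmas sym_sum = sym_linear[THEN linear_sum]
lemmas sym_scale = sym_linear[THEN linear_cmul]
lemmas sym_zero [simp] = sym_linear[THEN linear_0]

section \<open>Commutation relations of the Weyl algebra\<close>

lemma dx_mulx: "dx i (mulx j a) = mulx j (dx i a) + (if i = j then a else 0)"
  by (rule sym_eqI) (simp add: coef_dx coef_mulx_eq pd_mult_C_inf)

lemma dxi_mulxi: "dxi i (mulxi j a) = mulxi j (dxi i a) + (if i = j then a else 0)"
  by (rule sym_eqI, cases "i = j")
    (auto simp: mi_inc_apply mi_dec_apply mi_inc_dec_commute algebra_simps)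

lemma dx_commute: "dx i (dx j a) = dx j (dx i a)"
  by (rule sym_eqI) (simp add: coef_dx pd_commute)

lemma dxi_commute: "dxi i (dxi j a) = dxi j (dxi i a)"
  by (rule sym_eqI, cases "i = j") (auto simp: mi_inc_apply mi_inc_commute)

lemma mulxi_mulx: "mulxi i (mulx j a) = mulx j (mulxi i a)"
  and dxi_mulx: "dxi i (mulx j a) = mulx j (dxi i a)"
  by (rule sym_eqI; simp)+

lemma dx_mulxi: "dx i (mulxi j a) = mulxi j (dx i a)"
  by (rule sym_eqI) (simp add: coef_dx coef_mulxi_eq)

lemma dxi_dx: "dxi i (dx j a) = dx j (dxi i a)"
  by (rule sym_eqI) (simp add: coef_dx coef_dxi_eq pd_cmult_C_inf)

lemma wt_mulx: "wt \<phi> (mulx i a) = mulx i (wt \<phi> a)"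
  by (rule sym_eqI) simp

lemma wt_dx: "wt \<phi> (dx i a) = dx i (wt \<phi> a)"
  by (rule sym_eqI) (simp add: coef_dx coef_wt_eq pd_cmult_C_inf)

lemma dxi_wt: "dxi i (wt \<phi> a) = wt (\<lambda>l. \<phi> (Suc l)) (dxi i a)"
  by (rule sym_eqI) simp

lemma wt_mulxi_dxi: "wt \<phi> (mulxi i (dxi j a)) = mulxi i (dxi j (wt \<phi> a))"
  by (rule sym_eqI) (auto simp: mi_degree_dec)

lemma wt_wt: "wt \<phi> (wt \<psi> a) = wt (\<lambda>l. \<phi> l * \<psi> l) a"
  by (rule sym_eqI) simp

lemma wt_affine: "wt (\<lambda>l. p * real l + q) a = p *\<^sub>R wt real a + q *\<^sub>R a"
  by (rule sym_eqI) (simp add: algebra_simps)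

lemma wt_one [simp]: "wt (\<lambda>l. 1) a = a"
  by (rule sym_eqI) simp

lemma sum_mulxi_dxi: "(\<Sum>i\<in>UNIV. mulxi i (dxi i a)) = wt real a"
proof (rule sym_eqI)
  fix \<alpha> :: "'a \<Rightarrow> nat" and x
  have "coef (mulxi i (dxi i a)) \<alpha> x = real (\<alpha> i) * coef a \<alpha> x" for i
    by (auto simp: mi_dec_apply)
  then show "coef (\<Sum>i\<in>UNIV. mulxi i (dxi i a)) \<alpha> x = coef (wt real a) \<alpha> x"
    by (simp add: mi_degree_def sum_distrib_right)
qed

definition euler :: "'n::finite sym \<Rightarrow> 'n sym"
  where "euler a = (\<Sum>i\<in>UNIV. mulx i (dx i a))"

definition x_dot_xi :: "'n::finite sym \<Rightarrow> 'n sym"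
  where "x_dot_xi a = (\<Sum>i\<in>UNIV. mulx i (mulxi i a))"

definition divg :: "'n::finite sym \<Rightarrow> 'n sym"
  where "divg a = (\<Sum>i\<in>UNIV. dx i (dxi i a))"

lemma linear_euler: "linear euler"
  and linear_x_dot_xi: "linear x_dot_xi"
  and linear_divg: "linear divg"
  by (rule linearI; simp add: euler_def x_dot_xi_def divg_def sym_add sym_scale sum.distrib scaleR_sum_right)+

lemmas vector_op_linear = linear_euler linear_x_dot_xi linear_divg
lemmas vector_op_add = vector_op_linear[THEN linear_add]
lemmas vector_op_diff = vector_op_linear[THEN linear_diff]
lemmas vector_op_scale = vector_op_linear[THEN linear_cmul]

lemma dx_euler: "dx j (euler a) = euler (dx j a) + dx j a"
  by (simp add: euler_def sym_sum dx_mulx dx_commute[of j] sum.distrib)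

lemma euler_dxi: "euler (dxi j a) = dxi j (euler a)"
  by (simp add: euler_def sym_sum dxi_mulx dxi_dx)

lemma euler_wt: "euler (wt \<phi> a) = wt \<phi> (euler a)"
  by (simp add: euler_def sym_sum wt_mulx wt_dx)

lemma divg_mulx: "divg (mulx j a) = mulx j (divg a) + dxi j a"
  by (simp add: divg_def sym_sum dxi_mulx dx_mulx sum.distrib)

lemma divg_mulxi: "divg (mulxi j a) = mulxi j (divg a) + dx j a"
  by (simp add: divg_def sym_sum dxi_mulxi sym_add dx_mulxi sum.distrib if_distrib[of "dx _"]
      cong: if_cong)

lemma divg_dx: "divg (dx j a) = dx j (divg a)"
  by (simp add: divg_def sym_sum dxi_dx dx_commute[of j])

lemma divg_dxi: "divg (dxi j a) = dxi j (divg a)"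
  by (simp add: divg_def sym_sum dxi_dx dxi_commute[of j])

lemma divg_wt: "divg (wt \<phi> a) = wt (\<lambda>l. \<phi> (Suc l)) (divg a)"
  by (simp add: divg_def sym_sum dxi_wt wt_dx)

lemma divg_euler: "divg (euler a) = euler (divg a) + divg a"
  by (simp add: divg_def linear_sum[OF linear_euler] flip: sum.distrib)
    (simp add: dx_euler flip: euler_dxi)

text \<open>\<open>divg\<close> and \<open>x_dot_xi\<close> span, together with their commutator
  (the sum of the two Euler operators and m), a copy of sl(2).\<close>

lemma divg_x_dot_xi:
  fixes a :: "'n::finite sym"
  shows "divg (x_dot_xi a) = x_dot_xi (divg a) + euler a + wt real a + real CARD('n) *\<^sub>R a"
proof -
  have *: "dxi i (mulxi i a) = mulxi i (dxi i a) + a" for i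
    by (simp add: dxi_mulxi)
  have "divg (x_dot_xi a) = (\<Sum>i\<in>UNIV. mulx i (mulxi i (divg a)) + mulx i (dx i a) + (mulxi i (dxi i a) + a))"
    by (simp add: x_dot_xi_def linear_sum[OF linear_divg] divg_mulx divg_mulxi sym_add *)
  then show ?thesis
    by (simp add: sum.distrib sum_mulxi_dxi x_dot_xi_def euler_def sum_constant_scaleR add_ac)
qed

text \<open>The Lie derivatives of tensor fields along linear_field j i (up to the density term) and
  quadratic_field j. Constant fields act by \<^const>\<open>dx\<close>.\<close>

definition gl_gen :: "'n::finite \<Rightarrow> 'n \<Rightarrow> 'n sym \<Rightarrow> 'n sym"
  where "gl_gen j i a = mulx j (dx i a) - mulxi i (dxi j a)"

definition quad_gen :: "real \<Rightarrow> 'n::finite \<Rightarrow> 'n sym \<Rightarrow> 'n sym"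
  where "quad_gen \<delta> j a = mulx j (euler a) - x_dot_xi (dxi j a) - mulx j (wt real a)
    + (\<delta> * (real CARD('n) + 1)) *\<^sub>R mulx j a"

lemma linear_gl_gen: "linear (gl_gen j i)"
  and linear_quad_gen: "linear (quad_gen \<delta> j)"
  by (rule linearI; simp add: gl_gen_def quad_gen_def sym_add sym_scale vector_op_add vector_op_scale algebra_simps)+

text \<open>\<open>divg\<close> contracts the dual variables x and \<xi>: the two halves of
  \<open>gl_gen\<close> contribute the same extra term \<open>dx i (dxi j a)\<close> with opposite
  signs.\<close>

lemma divg_gl_gen: "divg (gl_gen j i a) = gl_gen j i (divg a)"
  by (simp add: gl_gen_def vector_op_diff divg_mulx divg_mulxi divg_dx divg_dxi dxi_dx)

lemma wt_gl_gen: "wt \<phi> (gl_gen j i a) = gl_gen j i (wt \<phi> a)"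
  by (simp add: gl_gen_def sym_diff wt_mulx wt_dx wt_mulxi_dxi)

lemma wt_x_dot_xi_dxi: "wt \<phi> (x_dot_xi (dxi j a)) = x_dot_xi (dxi j (wt \<phi> a))"
  by (simp add: x_dot_xi_def sym_sum wt_mulx wt_mulxi_dxi)

lemma wt_quad_gen: "wt \<phi> (quad_gen \<delta> j a) = quad_gen \<delta> j (wt \<phi> a)"
  by (simp add: quad_gen_def sym_diff sym_add sym_scale wt_mulx wt_x_dot_xi_dxi euler_wt wt_wt mult.commute)

lemma wt_Suc: "wt (\<lambda>l. real (Suc l)) a = wt real a + a"
  by (rule sym_eqI) (simp add: algebra_simps)

text \<open>The extra terms \<open>mulx j (divg a)\<close> and \<open>euler (dxi j a)\<close> each
  occur twice with opposite signs. The surviving multiple of \<open>dxi j a\<close> collects -2 l -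
  1 from the degree, -m from \<open>divg_x_dot_xi\<close> and (m + 1) \<delta> from the density;
  this is the origin of \<theta>.\<close>

lemma divg_quad_gen:
  fixes a :: "'n::finite sym"
  defines "\<theta> \<equiv> \<lambda>\<delta>. (real CARD('n) + 1) * \<delta> - real CARD('n)"
  shows "divg (quad_gen \<delta> j a) = quad_gen \<delta> j (divg a) + wt (\<lambda>l. \<theta> \<delta> - 2 * real l - 1) (dxi j a)"
proof -
  have w: "wt (\<lambda>l. \<theta> \<delta> - 2 * real l - 1) (dxi j a) = (-2) *\<^sub>R wt real (dxi j a) + (\<theta> \<delta> - 1) *\<^sub>R dxi j a"
    by (rule sym_eqI) (simp add: algebra_simps)
  have "divg (quad_gen \<delta> j a) = (mulx j (euler (divg a)) + mulx j (divg a) + euler (dxi j a))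
     - (x_dot_xi (dxi j (divg a)) + euler (dxi j a) + wt real (dxi j a) + real CARD('n) *\<^sub>R dxi j a)
     - (mulx j (wt real (divg a)) + mulx j (divg a) + (wt real (dxi j a) + dxi j a))
     + (\<delta> * (real CARD('n) + 1)) *\<^sub>R (mulx j (divg a) + dxi j a)"
    by (simp add: quad_gen_def vector_op_diff vector_op_add vector_op_scale divg_mulx divg_euler divg_x_dot_xi divg_dxi divg_wt dxi_wt
        wt_Suc sym_add euler_dxi del: of_nat_Suc)
  then show ?thesis
    unfolding w by (simp add: quad_gen_def \<theta>_def algebra_simps scaleR_2)
qed

section \<open>The equivariant symbol map\<close>

text \<open>Up to normalization and an additive constant, the Casimir element of sl(m+1). It acts on
  degree l by a scalar, and the scalars of two degrees k > l differ by
  2 (k - l) (k + l - ((m + 1) \<delta> - m)).\<close>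

definition Casimir :: "real \<Rightarrow> 'n::finite sym \<Rightarrow> 'n sym"
  where "Casimir \<delta> a = (\<Sum>j\<in>UNIV. \<Sum>i\<in>UNIV. gl_gen j i (gl_gen i j a))
    + (\<Sum>i\<in>UNIV. gl_gen i i (\<Sum>l\<in>UNIV. gl_gen l l a))
    - 2 *\<^sub>R (\<Sum>j\<in>UNIV. quad_gen \<delta> j (dx j a))
    - ((real CARD('n) + 1) * (1 - 2 * \<delta>)) *\<^sub>R (\<Sum>i\<in>UNIV. gl_gen i i a)"

lemma wt_real_dxi: "wt real (dxi i a) = dxi i (wt real a) - dxi i a"
  by (simp add: dxi_wt wt_Suc del: of_nat_Suc)

lemma sum_gl_gen_diag: "(\<Sum>i\<in>UNIV. gl_gen i i a) = euler a - wt real a"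
  by (simp add: gl_gen_def sum_subtractf euler_def sum_mulxi_dxi)

lemma sum_dx_mulx:
  fixes a :: "'n::finite sym"
  shows "(\<Sum>i\<in>UNIV. dx i (mulx i a)) = euler a + real CARD('n) *\<^sub>R a"
  by (simp add: dx_mulx sum.distrib euler_def sum_constant_scaleR)

lemma sum_dxi_mulxi:
  fixes a :: "'n::finite sym"
  shows "(\<Sum>i\<in>UNIV. dxi i (mulxi i a)) = wt real a + real CARD('n) *\<^sub>R a"
  by (simp add: dxi_mulxi sum.distrib sum_mulxi_dxi sum_constant_scaleR)

lemma sum_mulx_euler_dx: "(\<Sum>j\<in>UNIV. mulx j (euler (dx j a))) = euler (euler a) - euler a"
proof -
  have "mulx j (euler (dx j a)) = mulx j (dx j (euler a)) - mulx j (dx j a)" for j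
    by (simp add: dx_euler sym_diff[symmetric])
  then show ?thesis
    by (simp add: sum_subtractf) (simp add: euler_def)
qed

text \<open>Normal ordering leaves a single term that is not a function of the two Euler operators,
  namely \<open>x_dot_xi (divg a)\<close>; both mixed products contribute it, hence the factor
  2.\<close>

lemma sum_gl_gen_gl_gen:
  fixes a :: "'n::finite sym"
  shows "(\<Sum>j\<in>UNIV. \<Sum>i\<in>UNIV. gl_gen j i (gl_gen i j a))
    = euler (euler a) + (real CARD('n) - 1) *\<^sub>R euler a - 2 *\<^sub>R x_dot_xi (divg a)
      + wt real (wt real a) + (real CARD('n) - 1) *\<^sub>R wt real a"
proof -
  have "gl_gen j i (gl_gen i j a) = mulx j (dx i (mulx i (dx j a))) - mulx j (mulxi j (dx i (dxi i a)))
      - mulx i (mulxi i (dx j (dxi j a))) + mulxi i (dxi j (mulxi j (dxi i a)))" for i j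
    by (simp add: gl_gen_def sym_diff dx_mulxi dxi_mulx mulxi_mulx dxi_dx)
  then have "(\<Sum>j\<in>UNIV. \<Sum>i\<in>UNIV. gl_gen j i (gl_gen i j a))
    = (\<Sum>j\<in>UNIV. mulx j (\<Sum>i\<in>UNIV. dx i (mulx i (dx j a))))
      - (\<Sum>j\<in>UNIV. mulx j (mulxi j (\<Sum>i\<in>UNIV. dx i (dxi i a))))
      - (\<Sum>j\<in>UNIV. \<Sum>i\<in>UNIV. mulx i (mulxi i (dx j (dxi j a))))
      + (\<Sum>j\<in>UNIV. \<Sum>i\<in>UNIV. mulxi i (dxi j (mulxi j (dxi i a))))"
    by (simp add: sum.distrib sum_subtractf sym_sum)
  also have "(\<Sum>j\<in>UNIV. \<Sum>i\<in>UNIV. mulx i (mulxi i (dx j (dxi j a)))) = x_dot_xi (divg a)"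
    by (subst sum.swap) (simp add: x_dot_xi_def divg_def sym_sum)
  also have "(\<Sum>j\<in>UNIV. \<Sum>i\<in>UNIV. mulxi i (dxi j (mulxi j (dxi i a))))
      = (\<Sum>i\<in>UNIV. mulxi i (\<Sum>j\<in>UNIV. dxi j (mulxi j (dxi i a))))"
    by (subst sum.swap) (simp add: sym_sum)
  also have "\<dots> = (\<Sum>i\<in>UNIV. mulxi i (dxi i (wt real a)) + (real CARD('n) - 1) *\<^sub>R mulxi i (dxi i a))"
    by (simp add: sum_dxi_mulxi wt_real_dxi sym_add sym_diff sym_scale algebra_simps)
  also have "\<dots> = wt real (wt real a) + (real CARD('n) - 1) *\<^sub>R wt real a"
    by (simp add: sum.distrib sum_mulxi_dxi flip: scaleR_sum_right)
  also have "(\<Sum>j\<in>UNIV. mulx j (\<Sum>i\<in>UNIV. dx i (mulx i (dx j a))))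
      = (\<Sum>j\<in>UNIV. mulx j (euler (dx j a))) + real CARD('n) *\<^sub>R euler a"
    by (simp add: sum_dx_mulx sym_add sym_scale sum.distrib euler_def flip: scaleR_sum_right)
  also have "(\<Sum>j\<in>UNIV. mulx j (mulxi j (\<Sum>i\<in>UNIV. dx i (dxi i a)))) = x_dot_xi (divg a)"
    by (simp add: x_dot_xi_def divg_def)
  finally show ?thesis
    by (simp add: sum_mulx_euler_dx algebra_simps scaleR_2)
qed

lemma sum_quad_gen_dx:
  fixes a :: "'n::finite sym"
  shows "(\<Sum>j\<in>UNIV. quad_gen \<delta> j (dx j a))
    = euler (euler a) - euler a - x_dot_xi (divg a) - euler (wt real a) + (\<delta> * (real CARD('n) + 1)) *\<^sub>R euler a"
  by (simp add: quad_gen_def sum.distrib sum_subtractf sum_mulx_euler_dx linear_sum[OF linear_x_dot_xi, symmetric]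
      dxi_dx wt_dx flip: scaleR_sum_right)
    (simp add: divg_def euler_def)

text \<open>The factor -2 in front of the quadratic part cancels \<open>x_dot_xi (divg a)\<close>,
  the square of \<open>euler\<close> and its product with the degree. The coefficient of the last
  summand of \<open>Casimir\<close> cancels the term linear in \<open>euler\<close>. Only the degree
  remains.\<close>

lemma Casimir_eq:
  fixes a :: "'n::finite sym"
  shows "Casimir \<delta> a
    = wt (\<lambda>l. 2 * real l * (real l + real CARD('n) - \<delta> * (real CARD('n) + 1))) a"
proof -
  have "Casimir \<delta> a = 2 *\<^sub>R wt real (wt real a)
      + (2 * (real CARD('n) - \<delta> * (real CARD('n) + 1))) *\<^sub>R wt real a"
    unfolding Casimir_def sum_gl_gen_diag sum_gl_gen_gl_gen sum_quad_gen_dx vector_op_diff sym_diff euler_wt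
    by (rule sym_eqI) (simp add: algebra_simps)
  also have "\<dots> = wt (\<lambda>l. 2 * real l * (real l + real CARD('n) - \<delta> * (real CARD('n) + 1))) a"
    by (rule sym_eqI) (simp add: algebra_simps)
  finally show ?thesis .
qed

text \<open>The bound is strict so that inductions can start from the zero symbol; operators of
  order at most k correspond to \<open>deg_lt (Suc k)\<close>.\<close>

definition deg_lt :: "nat \<Rightarrow> 'n::finite sym \<Rightarrow> bool"
  where "deg_lt n a \<longleftrightarrow> (\<forall>\<alpha>. n \<le> mi_degree \<alpha> \<longrightarrow> coef a \<alpha> = (\<lambda>x. 0))"

lemma deg_lt_iff: "deg_lt n a \<longleftrightarrow> (\<forall>\<alpha> x. n \<le> mi_degree \<alpha> \<longrightarrow> coef a \<alpha> x = 0)"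
  by (auto simp: deg_lt_def fun_eq_iff)

lemma ex_deg_lt: "\<exists>n. deg_lt n a"
  using coef[of a] by (auto simp: deg_lt_def bounded_support_def)

lemma deg_lt_mono: "deg_lt m a \<Longrightarrow> m \<le> n \<Longrightarrow> deg_lt n a"
  by (simp add: deg_lt_def)

lemma deg_lt_0 [simp]: "deg_lt 0 a \<longleftrightarrow> a = 0"
  by (auto simp: deg_lt_iff intro: sym_eqI)

lemma deg_lt_add: "deg_lt n a \<Longrightarrow> deg_lt n b \<Longrightarrow> deg_lt n (a + b)"
  and deg_lt_diff: "deg_lt n a \<Longrightarrow> deg_lt n b \<Longrightarrow> deg_lt n (a - b)"
  and deg_lt_scaleR: "deg_lt n a \<Longrightarrow> deg_lt n (c *\<^sub>R a)"
  and deg_lt_wt: "deg_lt n a \<Longrightarrow> deg_lt n (wt \<phi> a)"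
  and deg_lt_mulx: "deg_lt n a \<Longrightarrow> deg_lt n (mulx i a)"
  by (simp_all add: deg_lt_iff)

lemma deg_lt_sum: "(\<And>i. i \<in> I \<Longrightarrow> deg_lt n (a i)) \<Longrightarrow> deg_lt n (\<Sum>i\<in>I. a i)"
  by (simp add: deg_lt_iff)

lemma deg_lt_dx: "deg_lt n a \<Longrightarrow> deg_lt n (dx i a)"
  by (simp add: deg_lt_def coef_dx)

lemma deg_lt_dxi: "deg_lt n a \<Longrightarrow> deg_lt (n - 1) (dxi i a)"
  by (simp add: deg_lt_iff)

lemma deg_lt_mulxi: "deg_lt n a \<Longrightarrow> deg_lt (Suc n) (mulxi i a)"
proof -
  assume a: "deg_lt n a"
  have "n \<le> mi_degree (mi_dec i \<alpha>)" if "Suc n \<le> mi_degree \<alpha>" "\<alpha> i \<noteq> 0" for \<alpha>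
    using that mi_degree_dec[of \<alpha> i] by simp
  then show ?thesis
    using a by (simp add: deg_lt_iff)
qed

lemma deg_lt_mulxi_dxi: "deg_lt n a \<Longrightarrow> deg_lt n (mulxi i (dxi j a))"
  using deg_lt_mulxi[OF deg_lt_dxi[of n a j], of i] by (cases n) auto

lemma deg_lt_divg_pow: "deg_lt n a \<Longrightarrow> deg_lt (n - r) ((divg ^^ r) a)"
proof (induction r)
  case (Suc r)
  then have "deg_lt (n - Suc r) (dx i (dxi i ((divg ^^ r) a)))" for i
    using deg_lt_dx[OF deg_lt_dxi[of "n - r" "(divg ^^ r) a" i]] by simp
  then show ?case
    by (simp add: divg_def[of "(divg ^^ r) a"] deg_lt_sum)
qed simp

lemma linear_divg_pow: "linear (divg ^^ r)"
proof (induction r)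
  case (Suc r)
  then show ?case
    unfolding funpow.simps by (rule linear_compose[OF _ linear_divg])
qed (simp add: linear_ident)

lemma divg_pow_dx: "(divg ^^ r) (dx i a) = dx i ((divg ^^ r) a)"
  by (induction r) (simp_all add: divg_dx)

lemma divg_pow_dxi: "(divg ^^ r) (dxi i a) = dxi i ((divg ^^ r) a)"
  by (induction r) (simp_all add: divg_dxi)

lemma divg_pow_gl_gen: "(divg ^^ r) (gl_gen j i a) = gl_gen j i ((divg ^^ r) a)"
  by (induction r) (simp_all add: divg_gl_gen)

lemma divg_pow_wt: "(divg ^^ r) (wt \<phi> a) = wt (\<lambda>l. \<phi> (l + r)) ((divg ^^ r) a)"
  by (induction r) (simp_all add: divg_wt)

lemma wt_add: "wt (\<lambda>l. \<phi> l + \<psi> l) a = wt \<phi> a + wt \<psi> a"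
  by (rule sym_eqI) (simp add: algebra_simps)

text \<open>The commutator with a power is the sum of the commutators at each position. Every later
  factor \<open>divg\<close> shifts the weight by one degree, so the weights form an arithmetic
  progression, summed here in closed form.\<close>

lemma divg_pow_Suc_quad_gen:
  fixes a :: "'n::finite sym"
  assumes "\<theta> = (real CARD('n) + 1) * \<delta> - real CARD('n)"
  shows "(divg ^^ Suc r) (quad_gen \<delta> j a) = quad_gen \<delta> j ((divg ^^ Suc r) a)
    + wt (\<lambda>l. (real r + 1) * (\<theta> - 2 * real l - (real r + 1))) (dxi j ((divg ^^ r) a))"
proof (induction r)
  case 0
  then show ?case
    by (simp add: divg_quad_gen assms)
next
  case (Suc r)
  have "(divg ^^ Suc (Suc r)) (quad_gen \<delta> j a) = divg ((divg ^^ Suc r) (quad_gen \<delta> j a))"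
    by simp
  also have "\<dots> = quad_gen \<delta> j ((divg ^^ Suc (Suc r)) a)
      + (wt (\<lambda>l. \<theta> - 2 * real l - 1) (dxi j ((divg ^^ Suc r) a))
       + wt (\<lambda>l. (real r + 1) * (\<theta> - 2 * real (Suc l) - (real r + 1))) (dxi j ((divg ^^ Suc r) a)))"
    unfolding Suc.IH by (simp add: vector_op_add divg_quad_gen divg_wt divg_dxi assms add.assoc)
  also have "\<dots> = quad_gen \<delta> j ((divg ^^ Suc (Suc r)) a)
      + wt (\<lambda>l. (real (Suc r) + 1) * (\<theta> - 2 * real l - (real (Suc r) + 1))) (dxi j ((divg ^^ Suc r) a))"
    unfolding wt_add[symmetric] by (simp add: algebra_simps)
  finally show ?case .
qed

text \<open>The coefficients solve e (r + 1) l * (r + 1) * (\<theta> - 2 l - (r + 1)) = e r l * (l + r + c), which is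
  what equivariance under the quadratic fields imposes on \<Sum>r. e r l * divg^r by
  \<open>divg_pow_Suc_quad_gen\<close>.\<close>

definition proj_symbol_coeff :: "real \<Rightarrow> real \<Rightarrow> nat \<Rightarrow> nat \<Rightarrow> real"
  where "proj_symbol_coeff \<theta> c r l
    = (\<Prod>s<r. (real l + real s + c) / ((real s + 1) * (\<theta> - 2 * real l - (real s + 1))))"

lemma proj_symbol_coeff_0: "proj_symbol_coeff \<theta> c 0 = (\<lambda>l. 1)"
  by (simp add: proj_symbol_coeff_def fun_eq_iff)

text \<open>\<open>divg\<close> lowers the degree, so the series terminates and any degree bound may
  serve as the cutoff; \<open>LEAST\<close> only selects one.\<close>

definition proj_symbol :: "real \<Rightarrow> real \<Rightarrow> 'n::finite sym \<Rightarrow> 'n sym"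
  where "proj_symbol \<theta> c a = (\<Sum>r<(LEAST n. deg_lt n a). wt (proj_symbol_coeff \<theta> c r) ((divg ^^ r) a))"

lemma proj_symbol_eq:
  assumes "deg_lt n a"
  shows "proj_symbol \<theta> c a = (\<Sum>r<n. wt (proj_symbol_coeff \<theta> c r) ((divg ^^ r) a))"
proof -
  let ?d = "LEAST n. deg_lt n a"
  have d: "deg_lt ?d a" "?d \<le> n"
    using assms by (auto intro: LeastI Least_le)
  have "wt (proj_symbol_coeff \<theta> c r) ((divg ^^ r) a) = 0" if "?d \<le> r" for r
    using deg_lt_divg_pow[OF d(1), of r] that by simp
  then show ?thesis
    unfolding proj_symbol_def using d(2) by (intro sum.mono_neutral_left) auto
qed

lemma linear_proj_symbol: "linear (proj_symbol \<theta> c)"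
proof (rule linearI)
  fix a b :: "'a sym" and r :: real
  obtain m n where "deg_lt m a" "deg_lt n b"
    using ex_deg_lt by blast
  then have ab: "deg_lt (max m n) a" "deg_lt (max m n) b"
    by (auto intro: deg_lt_mono)
  show "proj_symbol \<theta> c (a + b) = proj_symbol \<theta> c a + proj_symbol \<theta> c b"
    unfolding proj_symbol_eq[OF ab(1)] proj_symbol_eq[OF ab(2)] proj_symbol_eq[OF deg_lt_add[OF ab]]
    by (simp add: linear_add[OF linear_divg_pow] sym_add sum.distrib)
  show "proj_symbol \<theta> c (r *\<^sub>R a) = r *\<^sub>R proj_symbol \<theta> c a"
    unfolding proj_symbol_eq[OF ab(1)] proj_symbol_eq[OF deg_lt_scaleR[OF ab(1)]]
    by (simp add: linear_cmul[OF linear_divg_pow] sym_scale scaleR_sum_right)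
qed

lemma proj_symbol_triangular:
  assumes "deg_lt (Suc n) a"
  shows "deg_lt n (proj_symbol \<theta> c a - a)"
proof -
  have "proj_symbol \<theta> c a - a = (\<Sum>r<n. wt (proj_symbol_coeff \<theta> c (Suc r)) ((divg ^^ Suc r) a))"
    unfolding proj_symbol_eq[OF assms] sum.lessThan_Suc_shift by (simp add: proj_symbol_coeff_0)
  moreover have "deg_lt n ((divg ^^ Suc r) a)" for r
    using deg_lt_divg_pow[OF assms, of "Suc r"] by (rule deg_lt_mono) simp
  ultimately show ?thesis
    by (simp add: deg_lt_sum deg_lt_wt del: funpow.simps)
qed

text \<open>On symbols of bounded degree \<open>T\<close> is the identity plus a nilpotent map. No
  finite dimension is available, so kernel and range are treated separately by induction on the
  bound.\<close>

lemma unitriangular_bij: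
  fixes T :: "'n::finite sym \<Rightarrow> 'n sym"
  assumes T: "linear T" and tri: "\<And>n a. deg_lt (Suc n) a \<Longrightarrow> deg_lt n (T a - a)"
  shows "bij T"
proof (rule bijI)
  have ker: "a = 0" if "deg_lt n a" "T a = 0" for n a
    using that
  proof (induction n)
    case (Suc n)
    have "deg_lt n ((-1) *\<^sub>R (T a - a))"
      using tri[OF Suc.prems(1)] by (rule deg_lt_scaleR)
    then show ?case
      using Suc by simp
  qed simp
  show "inj T"
    unfolding linear_injective_0[OF T] using ex_deg_lt ker by blast
  have "b \<in> range T" if "deg_lt n b" for n b
    using that
  proof (induction n arbitrary: b)
    case 0
    then show ?case
      using linear_0[OF T] by (metis deg_lt_0 rangeI)
  next
    case (Suc n)
    \<comment> \<open>\<open>b\<close> is a preimage of itself up to an error of lower degree, which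
      already has a preimage \<open>c\<close>.\<close>
    from tri[OF Suc.prems] obtain c where c: "T b - b = T c"
      using Suc.IH by blast
    have "b = T (b - c)"
      using c by (simp add: linear_diff[OF T] algebra_simps)
    then show ?case by blast
  qed
  then show "surj T"
    using ex_deg_lt by blast
qed

lemma deg_lt_quad_gen: "deg_lt n a \<Longrightarrow> deg_lt n (quad_gen \<delta> j a)"
  unfolding quad_gen_def euler_def x_dot_xi_def
  by (intro deg_lt_add deg_lt_diff deg_lt_sum deg_lt_scaleR deg_lt_mulx deg_lt_wt deg_lt_mulxi_dxi deg_lt_dx)

lemma deg_lt_gl_gen: "deg_lt n a \<Longrightarrow> deg_lt n (gl_gen j i a)"
  unfolding gl_gen_def by (intro deg_lt_diff deg_lt_mulx deg_lt_mulxi_dxi deg_lt_dx)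

lemma proj_symbol_dx: "proj_symbol \<theta> c (dx i a) = dx i (proj_symbol \<theta> c a)"
proof -
  obtain n where n: "deg_lt n a"
    using ex_deg_lt by blast
  show ?thesis
    unfolding proj_symbol_eq[OF n] proj_symbol_eq[OF deg_lt_dx[OF n]] by (simp add: divg_pow_dx wt_dx sym_sum)
qed

lemma proj_symbol_gl_gen: "proj_symbol \<theta> c (gl_gen j i a) = gl_gen j i (proj_symbol \<theta> c a)"
proof -
  obtain n where n: "deg_lt n a"
    using ex_deg_lt by blast
  show ?thesis
    unfolding proj_symbol_eq[OF n] proj_symbol_eq[OF deg_lt_gl_gen[OF n]]
    by (simp add: divg_pow_gl_gen wt_gl_gen linear_sum[OF linear_gl_gen])
qed

text \<open>The commutator at index r + 1 and the discrepancy at index r are both multiples of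
  \<open>dxi j ((divg ^^ r) a)\<close> on each degree. The recursion for the coefficients equates
  them term by term.\<close>

lemma proj_symbol_quad_gen:
  fixes a :: "'n::finite sym"
  assumes \<theta>: "\<theta> = (real CARD('n) + 1) * \<delta> - real CARD('n)" "\<theta> \<notin> {real j | j :: nat. j \<ge> 1}"
  shows "proj_symbol \<theta> c (quad_gen \<delta> j a - wt (\<lambda>l. real l + c) (dxi j a)) = quad_gen \<delta> j (proj_symbol \<theta> c a)"
proof -
  obtain n0 where "deg_lt n0 a"
    using ex_deg_lt by blast
  \<comment> \<open>The bound is raised by one so that splitting off r = 0 leaves a sum over r < n0.
    The series of the discrepancy then has one further term, r = n0, which vanishes.\<close>
  then have n: "deg_lt (Suc n0) a" "deg_lt (Suc n0) (dxi j a)"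
    using deg_lt_dxi[of n0 a j] by (auto intro: deg_lt_mono)
  have n': "(divg ^^ n0) (dxi j a) = 0"
    using deg_lt_divg_pow[OF deg_lt_dxi[OF \<open>deg_lt n0 a\<close>], of n0 j] by simp
  let ?e = "proj_symbol_coeff \<theta> c"
  have nz: "\<theta> - 2 * real l - (real r + 1) \<noteq> 0" for l r
  proof
    assume "\<theta> - 2 * real l - (real r + 1) = 0"
    \<comment> \<open>A resonance pairs the degrees l and l + r + 1; their sum is a positive
      integer, which the hypothesis excludes.\<close>
    then have "\<theta> = real (2 * l + r + 1)" by simp
    then show False using \<theta>(2) by fastforce
  qed
  have e: "?e (Suc r) l * ((real r + 1) * (\<theta> - 2 * real l - (real r + 1))) = ?e r l * (real l + real r + c)" for r l
    using nz[of l r] by (simp add: proj_symbol_coeff_def)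
  have "proj_symbol \<theta> c (quad_gen \<delta> j a) = quad_gen \<delta> j a + (\<Sum>r<n0. wt (?e (Suc r)) ((divg ^^ Suc r) (quad_gen \<delta> j a)))"
    unfolding proj_symbol_eq[OF deg_lt_quad_gen[OF n(1)]] sum.lessThan_Suc_shift by (simp add: proj_symbol_coeff_0)
  also have "\<dots> = quad_gen \<delta> j a + (\<Sum>r<n0. wt (?e (Suc r)) (quad_gen \<delta> j ((divg ^^ Suc r) a)))
      + (\<Sum>r<n0. wt (\<lambda>l. ?e r l * (real l + real r + c)) (dxi j ((divg ^^ r) a)))"
    unfolding divg_pow_Suc_quad_gen[OF \<theta>(1)] sym_add wt_wt e by (simp add: sum.distrib add.assoc)
  also have "quad_gen \<delta> j a + (\<Sum>r<n0. wt (?e (Suc r)) (quad_gen \<delta> j ((divg ^^ Suc r) a))) = quad_gen \<delta> j (proj_symbol \<theta> c a)"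
    unfolding proj_symbol_eq[OF n(1)] sum.lessThan_Suc_shift
    by (simp add: proj_symbol_coeff_0 linear_add[OF linear_quad_gen] linear_sum[OF linear_quad_gen] wt_quad_gen)
  also have "(\<Sum>r<n0. wt (\<lambda>l. ?e r l * (real l + real r + c)) (dxi j ((divg ^^ r) a)))
      = proj_symbol \<theta> c (wt (\<lambda>l. real l + c) (dxi j a))"
    unfolding proj_symbol_eq[OF deg_lt_wt[OF n(2)]]
    by (simp add: divg_pow_wt wt_wt n' divg_pow_dxi[symmetric] del: funpow.simps)
  finally show ?thesis
    by (simp add: linear_diff[OF linear_proj_symbol])
qed

text \<open>A homogeneous symbol is an eigenvector of the Casimir element, and \<open>V\<close>
  sends it to an eigenvector with the same scalar but in lower degrees, where that scalar does not
  occur. Each symbol is a finite sum of homogeneous ones, so plain linearity suffices.\<close>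

lemma equivariant_lowering_zero:
  fixes V :: "'n::finite sym \<Rightarrow> 'n sym"
  assumes V: "linear V" and low: "\<And>n a. deg_lt (Suc n) a \<Longrightarrow> deg_lt n (V a)"
    and V_dx: "\<And>i a. V (dx i a) = dx i (V a)"
    and V_gl_gen: "\<And>j i a. V (gl_gen j i a) = gl_gen j i (V a)"
    and V_quad_gen: "\<And>j a. V (quad_gen \<delta> j a) = quad_gen \<delta> j (V a)"
    and \<theta>: "(real CARD('n) + 1) * \<delta> - real CARD('n) \<notin> {real j | j :: nat. j \<ge> 1}"
  shows "V a = 0"
proof -
  define \<gamma> where "\<gamma> l = 2 * real l * (real l + real CARD('n) - \<delta> * (real CARD('n) + 1))" for l
  have \<gamma>: "\<gamma> k \<noteq> \<gamma> l" if "l < k" for k l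
  proof
    assume "\<gamma> k = \<gamma> l"
    then have "(real k - real l) * (real k + real l - ((real CARD('n) + 1) * \<delta> - real CARD('n))) = 0"
      by (simp add: \<gamma>_def algebra_simps)
    then have "(real CARD('n) + 1) * \<delta> - real CARD('n) = real (k + l)"
      using that by auto
    moreover have "k + l \<ge> 1"
      using that by simp
    ultimately show False
      using \<theta> by blast
  qed
  have V_Casimir: "V (Casimir \<delta> a) = Casimir \<delta> (V a)" for a
    by (simp add: Casimir_def linear_add[OF V] linear_diff[OF V] linear_sum[OF V] linear_cmul[OF V]
        V_dx V_gl_gen V_quad_gen)
  then have V_wt: "V (wt \<gamma> a) = wt \<gamma> (V a)" for a
    unfolding Casimir_eq \<gamma>_def .
  have hom: "V (wt (\<lambda>l. if l = k then 1 else 0) a) = 0" for k a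
  proof -
    let ?a = "wt (\<lambda>l. if l = k then 1 else 0) a"
    have "deg_lt (Suc k) ?a"
      by (simp add: deg_lt_iff)
    then have d: "deg_lt k (V ?a)"
      by (rule low)
    have "wt \<gamma> ?a = \<gamma> k *\<^sub>R ?a"
      by (rule sym_eqI) simp
    then have "\<gamma> k *\<^sub>R V ?a = wt \<gamma> (V ?a)"
      using V_wt[of ?a] by (simp add: linear_cmul[OF V])
    then have eq: "\<gamma> k * coef (V ?a) \<alpha> x = \<gamma> (mi_degree \<alpha>) * coef (V ?a) \<alpha> x" for \<alpha> x
      by (metis coef_scaleR coef_wt)
    show "V ?a = 0"
    proof (rule sym_eqI)
      fix \<alpha> x
      show "coef (V ?a) \<alpha> x = coef 0 \<alpha> x"
        using d eq[of \<alpha> x] \<gamma>[of "mi_degree \<alpha>" k]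
        by (cases "k \<le> mi_degree \<alpha>") (auto simp: deg_lt_iff)
    qed
  qed
  obtain n where n: "deg_lt n a"
    using ex_deg_lt by blast
  have "a = (\<Sum>k<n. wt (\<lambda>l. if l = k then 1 else 0) a)"
  proof (rule sym_eqI)
    fix \<alpha> x
    have "coef (\<Sum>k<n. wt (\<lambda>l. if l = k then 1 else 0) a) \<alpha> x
        = (\<Sum>k<n. if mi_degree \<alpha> = k then coef a \<alpha> x else 0)"
      unfolding coef_sum coef_wt by (rule sum.cong) auto
    then show "coef a \<alpha> x = coef (\<Sum>k<n. wt (\<lambda>l. if l = k then 1 else 0) a) \<alpha> x"
      using n by (auto simp: deg_lt_iff not_less)
  qed
  then have "V a = (\<Sum>k<n. V (wt (\<lambda>l. if l = k then 1 else 0) a))"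
    using linear_sum[OF V] by metis
  then show ?thesis
    by (simp add: hom)
qed

text \<open>The action of a general element of \<open>sl\<close> with coefficients \<open>u\<close>,
  \<open>v\<close>, \<open>w\<close>. The term \<delta> for i = j is there because x_j d/dx_i has
  divergence 1 exactly then; \<open>quad_gen\<close> already contains its density term.\<close>

definition symbol_action :: "real \<Rightarrow> ('n::finite \<Rightarrow> real) \<Rightarrow> ('n \<Rightarrow> 'n \<Rightarrow> real) \<Rightarrow> ('n \<Rightarrow> real) \<Rightarrow> 'n sym \<Rightarrow> 'n sym"
  where "symbol_action \<delta> u v w p = (\<Sum>i\<in>UNIV. u i *\<^sub>R dx i p)
    + (\<Sum>j\<in>UNIV. \<Sum>i\<in>UNIV. v j i *\<^sub>R (gl_gen j i p + (if i = j then \<delta> else 0) *\<^sub>R p))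
    + (\<Sum>j\<in>UNIV. w j *\<^sub>R quad_gen \<delta> j p)"

text \<open>With c = lam * (m + 1), the Lie derivative of operators read on total symbols: it differs from
  that of tensor fields only along the quadratic fields.\<close>

definition operator_action :: "real \<Rightarrow> real \<Rightarrow> ('n::finite \<Rightarrow> real) \<Rightarrow> ('n \<Rightarrow> 'n \<Rightarrow> real) \<Rightarrow> ('n \<Rightarrow> real) \<Rightarrow> 'n sym \<Rightarrow> 'n sym"
  where "operator_action \<delta> c u v w p = symbol_action \<delta> u v w p - (\<Sum>j\<in>UNIV. w j *\<^sub>R wt (\<lambda>l. real l + c) (dxi j p))"

lemma operator_action_eq: "operator_action \<delta> c u v w p = (\<Sum>i\<in>UNIV. u i *\<^sub>R dx i p)
    + (\<Sum>j\<in>UNIV. \<Sum>i\<in>UNIV. v j i *\<^sub>R (gl_gen j i p + (if i = j then \<delta> else 0) *\<^sub>R p))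
    + (\<Sum>j\<in>UNIV. w j *\<^sub>R (quad_gen \<delta> j p - wt (\<lambda>l. real l + c) (dxi j p)))"
  by (simp add: operator_action_def symbol_action_def scaleR_diff_right sum_subtractf)

lemma proj_symbol_operator_action:
  fixes p :: "'n::finite sym"
  assumes "\<theta> = (real CARD('n) + 1) * \<delta> - real CARD('n)" "\<theta> \<notin> {real j | j :: nat. j \<ge> 1}"
  shows "proj_symbol \<theta> c (operator_action \<delta> c u v w p) = symbol_action \<delta> u v w (proj_symbol \<theta> c p)"
proof -
  note lin = linear_add[OF linear_proj_symbol] linear_sum[OF linear_proj_symbol] linear_cmul[OF linear_proj_symbol]
  show ?thesis
    unfolding operator_action_eq symbol_action_def lin proj_symbol_quad_gen[OF assms] proj_symbol_dx proj_symbol_gl_gen ..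
qed

lemma sum_if_scaleR:
  fixes f :: "'n::finite \<Rightarrow> 'b::real_vector"
  shows "(\<Sum>i\<in>UNIV. (if i = k then 1 else 0) *\<^sub>R f i) = f k"
proof -
  have "(\<Sum>i\<in>UNIV. (if i = k then 1 else 0) *\<^sub>R f i) = (\<Sum>i\<in>UNIV. if i = k then f i else 0)"
    by (rule sum.cong) auto
  then show ?thesis by simp
qed

lemma symbol_action_generators:
  shows "symbol_action \<delta> (\<lambda>i. if i = k then 1 else 0) (\<lambda>j i. 0) (\<lambda>j. 0) p = dx k p"
    and "symbol_action \<delta> (\<lambda>i. 0) (\<lambda>j i. if i = k then if j = l then 1 else 0 else 0) (\<lambda>j. 0) p
      = gl_gen l k p + (if k = l then \<delta> else 0) *\<^sub>R p"
    and "symbol_action \<delta> (\<lambda>i. 0) (\<lambda>j i. 0) (\<lambda>j. if j = k then 1 else 0) p = quad_gen \<delta> k p"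
proof -
  have "(\<Sum>j\<in>UNIV. \<Sum>i\<in>UNIV. (if i = k then if j = l then 1 else 0 else 0) *\<^sub>R (gl_gen j i p + (if i = j then \<delta> else 0) *\<^sub>R p))
    = (\<Sum>j\<in>UNIV. \<Sum>i\<in>UNIV. (if i = k then 1 else 0) *\<^sub>R (if j = l then 1 else 0) *\<^sub>R (gl_gen j i p + (if i = j then \<delta> else 0) *\<^sub>R p))"
    by (intro sum.cong) auto
  then show "symbol_action \<delta> (\<lambda>i. 0) (\<lambda>j i. if i = k then if j = l then 1 else 0 else 0) (\<lambda>j. 0) p
      = gl_gen l k p + (if k = l then \<delta> else 0) *\<^sub>R p"
    unfolding symbol_action_def sum_if_scaleR by simp
qed (simp_all add: symbol_action_def sum_if_scaleR)

text \<open>\<open>T\<close> and \<open>?S\<close> intertwine two different actions, so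
  \<open>T\<close> is composed with the inverse of \<open>?S\<close>. The defect \<open>V\<close>
  from the identity then commutes with a single action, that on tensor fields, where the Casimir
  element is diagonal.\<close>

lemma equivariant_symbol_unique:
  fixes T :: "'n::finite sym \<Rightarrow> 'n sym"
  assumes \<theta>: "\<theta> = (real CARD('n) + 1) * \<delta> - real CARD('n)" "\<theta> \<notin> {real j | j :: nat. j \<ge> 1}"
    and T: "linear T" and tri: "\<And>n a. deg_lt (Suc n) a \<Longrightarrow> deg_lt n (T a - a)"
    and equiv: "\<And>u v w a. T (operator_action \<delta> c u v w a) = symbol_action \<delta> u v w (T a)"
  shows "T = proj_symbol \<theta> c"
proof -
  let ?S = "proj_symbol \<theta> c"
  define R :: "'n sym \<Rightarrow> 'n sym" where "R = inv ?S"
  have bij: "bij ?S"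
    by (rule unitriangular_bij[OF linear_proj_symbol proj_symbol_triangular])
  have SR: "?S (R a) = a" and RS: "R (?S a) = a" for a
    unfolding R_def using surj_f_inv_f[OF bij_is_surj[OF bij]] inv_f_f[OF bij_is_inj[OF bij]] by auto
  have "linear R"
    by (rule linearI; metis SR RS linear_add[OF linear_proj_symbol] linear_cmul[OF linear_proj_symbol])
  have R_tri: "deg_lt n (R a - a)" if "deg_lt (Suc n) a" for n a
  proof -
    have "deg_lt (Suc n) (R a)"
    proof (rule ccontr)
      assume neg: "\<not> deg_lt (Suc n) (R a)"
      obtain N where "deg_lt (Suc n + N) (R a)"
        using ex_deg_lt by (metis deg_lt_mono le_add2)
      then have "deg_lt (Suc n) (R a)"
      proof (induction N)
        case (Suc N)
        \<comment> \<open>As \<open>?S (R a) = a\<close>, this difference is \<open>R a\<close>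
          itself: any degree bound of \<open>R a\<close> above that of \<open>a\<close> can be
          lowered by one.\<close>
        have "deg_lt (Suc n + N) (a - (?S (R a) - R a))" if "deg_lt (Suc (Suc n + N)) (R a)"
          by (rule deg_lt_diff[OF deg_lt_mono[OF \<open>deg_lt (Suc n) a\<close>] proj_symbol_triangular[OF that]]) simp
        then have "deg_lt (Suc n + N) (R a)"
          using Suc.prems by (simp add: SR)
        then show ?case
          by (rule Suc.IH)
      qed simp
      with neg show False by blast
    qed
    from deg_lt_scaleR[OF proj_symbol_triangular[OF this], of "-1" \<theta> c] show ?thesis
      by (simp add: SR)
  qed
  define V where "V a = T (R a) - a" for a
  have TR_symbol_action: "T (R (symbol_action \<delta> u v w a)) = symbol_action \<delta> u v w (T (R a))" for u v w a
  proof -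
    have "symbol_action \<delta> u v w a = ?S (operator_action \<delta> c u v w (R a))"
      by (simp add: proj_symbol_operator_action[OF \<theta>] SR)
    then show ?thesis
      by (simp add: RS equiv)
  qed
  have TR: "linear (\<lambda>a. T (R a))"
    using linear_compose[OF \<open>linear R\<close> T] by (simp add: o_def)
  have V: "linear V"
    unfolding V_def by (intro linear_compose_sub TR linear_ident)
  have "V a = 0" for a
  proof (rule equivariant_lowering_zero[OF V, where \<delta> = \<delta>])
    show "(real CARD('n) + 1) * \<delta> - real CARD('n) \<notin> {real j | j :: nat. j \<ge> 1}"
      using \<theta> by simp
    show "deg_lt n (V a)" if "deg_lt (Suc n) a" for n a
    proof -
      have "deg_lt (Suc n) ((R a - a) + a)"
        using R_tri[OF that] that by (intro deg_lt_add) (auto intro: deg_lt_mono)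
      then have "deg_lt n ((T (R a) - R a) + (R a - a))"
        using tri R_tri[OF that] by (intro deg_lt_add) auto
      then show ?thesis
        by (simp add: V_def)
    qed
    show "V (dx i a) = dx i (V a)" for i a
      using TR_symbol_action[of "\<lambda>l. if l = i then 1 else 0" "\<lambda>j i. 0" "\<lambda>j. 0" a]
      by (simp add: symbol_action_generators V_def sym_diff)
    \<comment> \<open>For i = j the action also contains the scalar \<delta>; it commutes with the
      linear map and cancels on both sides.\<close>
    show "V (gl_gen j i a) = gl_gen j i (V a)" for j i a
      using TR_symbol_action[of "\<lambda>i. 0" "\<lambda>l k. if k = i then if l = j then 1 else 0 else 0" "\<lambda>j. 0" a]
      by (simp add: symbol_action_generators V_def linear_diff[OF linear_gl_gen] linear_add[OF TR] linear_cmul[OF TR]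
          del: scaleR_right_diff_distrib)
    show "V (quad_gen \<delta> j a) = quad_gen \<delta> j (V a)" for j a
      using TR_symbol_action[of "\<lambda>i. 0" "\<lambda>l k. 0" "\<lambda>l. if l = j then 1 else 0" a]
      by (simp add: symbol_action_generators V_def linear_diff[OF linear_quad_gen])
  qed
  then have "T (R (?S a)) = ?S a" for a
    by (simp add: V_def)
  then show ?thesis
    by (simp add: RS fun_eq_iff)
qed

section \<open>Total symbols as operators and as tensor fields\<close>

text \<open>The condition on the degree is kept abstract because operators sum over degrees at most
  k and tensor fields over degree exactly k.\<close>

lemma sum_mi_dec_shift:
  fixes h :: "('n::finite \<Rightarrow> nat) \<Rightarrow> 'b::comm_monoid_add"
  assumes "finite {\<alpha> :: 'n \<Rightarrow> nat. Q (mi_degree \<alpha>)}"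
  shows "(\<Sum>\<alpha> | Q (mi_degree \<alpha>). if \<alpha> i = 0 then 0 else h (mi_dec i \<alpha>))
    = (\<Sum>\<beta> | Q (Suc (mi_degree \<beta>)). h \<beta>)"
proof -
  have "(\<Sum>\<alpha> | Q (mi_degree \<alpha>). if \<alpha> i = 0 then 0 else h (mi_dec i \<alpha>))
      = (\<Sum>\<alpha> | Q (mi_degree \<alpha>) \<and> \<alpha> i \<noteq> 0. h (mi_dec i \<alpha>))"
    using assms by (intro sum.mono_neutral_cong_right) auto
  also have "\<dots> = (\<Sum>\<beta> | Q (Suc (mi_degree \<beta>)). h \<beta>)"
    by (rule sum.reindex_bij_witness[of _ "mi_inc i" "mi_dec i"])
      (auto simp: mi_degree_dec mi_inc_apply)
  finally show ?thesis .
qed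

lemma finite_mi_degree_eq: "finite {\<alpha> :: 'n::finite \<Rightarrow> nat. mi_degree \<alpha> = k}"
  by (rule finite_subset[OF _ finite_mi_degree_le[of k]]) auto

text \<open>Normal-ordered quantization. For nonzero \<open>a\<close> the cutoff exceeds the order
  by one, which only adds vanishing coefficients.\<close>

definition quant :: "'n::finite sym \<Rightarrow> 'n operator"
  where "quant a = diff_op (LEAST n. deg_lt n a) (coef a)"

lemma quant_eq:
  assumes "deg_lt (Suc k) a"
  shows "quant a = diff_op k (coef a)"
proof -
  let ?d = "LEAST n. deg_lt n a"
  have d: "deg_lt ?d a"
    using assms by (rule LeastI)
  have le: "diff_op m (coef a) = diff_op n (coef a)" if "deg_lt (Suc m) a" "m \<le> n" for m n
  proof -
    have "(\<Sum>\<alpha> | mi_degree \<alpha> \<le> m. coef a \<alpha> x * pd_multi \<alpha> f x)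
        = (\<Sum>\<alpha> | mi_degree \<alpha> \<le> n. coef a \<alpha> x * pd_multi \<alpha> f x)" for f x
      using that by (intro sum.mono_neutral_left finite_mi_degree_le) (auto simp: deg_lt_iff not_le)
    then show ?thesis
      by (simp add: diff_op_def)
  qed
  show ?thesis
    unfolding quant_def using le[OF assms] le[of ?d k] deg_lt_mono[OF d, of "Suc ?d"]
    by (metis le_add2 nat_le_linear plus_1_eq_Suc)
qed

lemma quant_apply:
  assumes "deg_lt (Suc k) a" "f \<in> C_inf"
  shows "quant a f x = (\<Sum>\<alpha> | mi_degree \<alpha> \<le> k. coef a \<alpha> x * pd_multi \<alpha> f x)"
  using assms by (simp add: quant_eq diff_op_def)

lemma ex_deg_lt_Suc: "\<exists>k. deg_lt (Suc k) a"
  using ex_deg_lt[of a] deg_lt_mono by (metis le_add2 plus_1_eq_Suc)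

lemma quant_add_left:
  assumes f: "f \<in> C_inf"
  shows "quant (a + b) f x = quant a f x + quant b f x"
proof -
  obtain k l where "deg_lt (Suc k) a" "deg_lt (Suc l) b"
    using ex_deg_lt_Suc by blast
  then have ab: "deg_lt (Suc (max k l)) a" "deg_lt (Suc (max k l)) b"
    by (auto intro: deg_lt_mono)
  show ?thesis
    unfolding quant_apply[OF ab(1) f] quant_apply[OF ab(2) f] quant_apply[OF deg_lt_add[OF ab] f]
    by (simp add: sum.distrib algebra_simps)
qed

lemma quant_scaleR_left:
  assumes f: "f \<in> C_inf"
  shows "quant (c *\<^sub>R a) f x = c * quant a f x"
proof -
  obtain k where k: "deg_lt (Suc k) a"
    using ex_deg_lt_Suc by blast
  show ?thesis
    unfolding quant_apply[OF k f] quant_apply[OF deg_lt_scaleR[OF k] f]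
    by (simp add: sum_distrib_left mult.assoc)
qed

lemma quant_diff_left: "f \<in> C_inf \<Longrightarrow> quant (a - b) f x = quant a f x - quant b f x"
  using quant_add_left[of f "a - b" b x] by simp

lemma quant_zero_left: "f \<in> C_inf \<Longrightarrow> quant 0 f x = 0"
  using quant_diff_left[of f 0 0 x] by simp

lemma quant_sum_left: "f \<in> C_inf \<Longrightarrow> quant (\<Sum>i\<in>I. a i) f x = (\<Sum>i\<in>I. quant (a i) f x)"
  by (induction I rule: infinite_finite_induct) (simp_all add: quant_zero_left quant_add_left)

lemma quant_add_right:
  assumes "f \<in> C_inf" "g \<in> C_inf"
  shows "quant a (\<lambda>x. f x + g x) x = quant a f x + quant a g x"
proof -
  obtain k where "deg_lt (Suc k) a"
    using ex_deg_lt_Suc by blast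
  then show ?thesis
    by (simp add: quant_apply assms C_inf_add pd_multi_add sum.distrib algebra_simps)
qed

lemma quant_cmult_right:
  assumes "f \<in> C_inf"
  shows "quant a (\<lambda>x. c * f x) x = c * quant a f x"
proof -
  obtain k where "deg_lt (Suc k) a"
    using ex_deg_lt_Suc by blast
  then show ?thesis
    by (simp add: quant_apply assms C_inf_cmult pd_multi_cmult sum_distrib_left mult_ac)
qed

lemma quant_sum_right:
  "(\<And>i. i \<in> I \<Longrightarrow> f i \<in> C_inf) \<Longrightarrow> quant a (\<lambda>x. \<Sum>i\<in>I. f i x) x = (\<Sum>i\<in>I. quant a (f i) x)"
proof (induction I rule: infinite_finite_induct)
  case (insert i I)
  then show ?case
    by (simp add: quant_add_right C_inf_sum)
qed (use quant_cmult_right[of "\<lambda>x. 0" a 0 x] in simp_all)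

text \<open>With derivatives on the right, \<open>mulx\<close> is left multiplication by a
  coordinate and \<open>mulxi\<close> is right composition with a derivative, while
  \<open>dx\<close> and \<open>dxi\<close> are the commutators [d/dx_i, A] and [A, x_i]. These four
  rules transport every computation with operators to total symbols.\<close>

lemma quant_mulx: "f \<in> C_inf \<Longrightarrow> quant (mulx i a) f x = x $ i * quant a f x"
proof -
  assume f: "f \<in> C_inf"
  obtain k where k: "deg_lt (Suc k) a"
    using ex_deg_lt_Suc by blast
  show ?thesis
    unfolding quant_apply[OF k f] quant_apply[OF deg_lt_mulx[OF k] f]
    by (simp add: sum_distrib_left mult.assoc)
qed

lemma quant_dx:
  assumes f: "f \<in> C_inf"
  shows "pd i (quant a f) x = quant (dx i a) f x + quant a (pd i f) x"
proof -
  obtain k where k: "deg_lt (Suc k) a"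
    using ex_deg_lt_Suc by blast
  have "quant a f = (\<lambda>x. \<Sum>\<alpha> | mi_degree \<alpha> \<le> k. coef a \<alpha> x * pd_multi \<alpha> f x)"
    using quant_apply[OF k f] by blast
  then show ?thesis
    by (simp add: quant_apply[OF deg_lt_dx[OF k] f] quant_apply[OF k C_inf_pd[OF f]] pd_sum_C_inf pd_mult_C_inf
        C_inf_mult C_inf_pd_multi f coef_dx pd_multi_inc[OF f, symmetric] sum.distrib)
qed

lemma quant_mulxi:
  assumes f: "f \<in> C_inf"
  shows "quant (mulxi i a) f x = quant a (pd i f) x"
proof -
  obtain k where k: "deg_lt (Suc k) a"
    using ex_deg_lt_Suc by blast
  have "quant (mulxi i a) f x = (\<Sum>\<alpha> | mi_degree \<alpha> \<le> Suc k.
      if \<alpha> i = 0 then 0 else coef a (mi_dec i \<alpha>) x * pd_multi (mi_inc i (mi_dec i \<alpha>)) f x)"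
    unfolding quant_apply[OF deg_lt_mulxi[OF k] f] by (rule sum.cong) auto
  also have "\<dots> = (\<Sum>\<beta> | Suc (mi_degree \<beta>) \<le> Suc k. coef a \<beta> x * pd_multi (mi_inc i \<beta>) f x)"
    by (rule sum_mi_dec_shift) (rule finite_mi_degree_le)
  finally show ?thesis
    by (simp add: quant_apply[OF k C_inf_pd[OF f]] pd_multi_inc(2)[OF f])
qed

lemma quant_dxi:
  assumes f: "f \<in> C_inf"
  shows "quant a (\<lambda>y. y $ i * f y) x = x $ i * quant a f x + quant (dxi i a) f x"
proof -
  obtain k where k: "deg_lt (Suc k) a"
    using ex_deg_lt_Suc by blast
  \<comment> \<open>\<open>a\<close> is summed up to degree \<open>Suc k\<close> because the
    reindexing lowers the bound by one, back to k.\<close>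
  then have k': "deg_lt (Suc k) (dxi i a)" "deg_lt (Suc (Suc k)) a"
    using deg_lt_mono[OF deg_lt_dxi[OF k]] deg_lt_mono[OF k] by auto
  have "quant a (\<lambda>y. y $ i * f y) x = x $ i * quant a f x
      + (\<Sum>\<alpha> | mi_degree \<alpha> \<le> Suc k. coef a \<alpha> x * (real (\<alpha> i) * pd_multi (mi_dec i \<alpha>) f x))"
    unfolding quant_apply[OF k'(2) C_inf_mult[OF C_inf_component f]] quant_apply[OF k'(2) f]
      pd_multi_component_mult[OF f]
    by (simp add: sum.distrib sum_distrib_left algebra_simps)
  also have "(\<Sum>\<alpha> | mi_degree \<alpha> \<le> Suc k. coef a \<alpha> x * (real (\<alpha> i) * pd_multi (mi_dec i \<alpha>) f x))
     = (\<Sum>\<alpha> | mi_degree \<alpha> \<le> Suc k. if \<alpha> i = 0 then 0 else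
         coef (dxi i a) (mi_dec i \<alpha>) x * pd_multi (mi_dec i \<alpha>) f x)"
    by (rule sum.cong) (auto simp: mi_dec_apply)
  also have "\<dots> = (\<Sum>\<beta> | Suc (mi_degree \<beta>) \<le> Suc k. coef (dxi i a) \<beta> x * pd_multi \<beta> f x)"
    by (rule sum_mi_dec_shift) (rule finite_mi_degree_le)
  finally show ?thesis
    by (simp add: quant_apply[OF k'(1) f])
qed

lemma dxi_eq_0_imp:
  assumes "\<And>i. dxi i a = 0" "\<alpha> \<noteq> (\<lambda>i. 0)"
  shows "coef a \<alpha> x = 0"
proof -
  obtain i \<beta> where \<alpha>: "\<alpha> = mi_inc i \<beta>"
    using assms(2) by (rule mi_neq_0E)
  have "coef (dxi i a) \<beta> x = 0"
    by (simp only: assms(1) coef_zero)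
  then show ?thesis
    by (simp add: \<alpha>)
qed

text \<open>The commutator of the operator with multiplication by a coordinate is the operator of
  \<^term>\<open>dxi i a\<close>, so the kernel is stable under \<^const>\<open>dxi\<close>, which lowers the degree.\<close>

lemma quant_kernel:
  assumes "deg_lt n a" "\<And>f x. f \<in> C_inf \<Longrightarrow> quant a f x = 0"
  shows "a = 0"
  using assms
proof (induction n arbitrary: a)
  case (Suc n)
  have dxi0: "dxi i a = 0" for i
  proof (rule Suc.IH)
    show "deg_lt n (dxi i a)"
      using deg_lt_dxi[OF Suc.prems(1)] by simp
    show "quant (dxi i a) f x = 0" if "f \<in> C_inf" for f x
      using quant_dxi[OF that, of a i x] C_inf_mult[OF C_inf_component that, of i] Suc.prems(2) that by simp
  qed
  \<comment> \<open>Each coefficient of positive degree reappears, up to a nonzero factor, in some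
    \<open>dxi i a\<close>. Only the coefficient of order zero is left, and the constant function 1
    detects it.\<close>
  have "deg_lt (Suc 0) a"
    using dxi_eq_0_imp[OF dxi0] by (metis One_nat_def deg_lt_iff mi_degree_eq_0_iff not_one_le_zero)
  from quant_apply[OF this, of "\<lambda>x. 1"] have "coef a (\<lambda>i. 0) x = 0" for x
    using Suc.prems(2)[of "\<lambda>x. 1"] by simp
  then show ?case
    using dxi_eq_0_imp[OF dxi0] by (intro sym_eqI) (metis coef_zero)
qed simp

lemma inj_quant: "inj (quant :: 'n::finite sym \<Rightarrow> 'n operator)"
proof (rule injI)
  fix a b :: "'n sym"
  assume "quant a = quant b"
  then have "quant (a - b) f x = 0" if "f \<in> C_inf" for f x
    by (simp add: quant_diff_left that)
  then show "a = b"
    using quant_kernel ex_deg_lt eq_iff_diff_eq_0 by metis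
qed

lemma quant_extensional: "f \<notin> C_inf \<Longrightarrow> quant a f = undefined"
  by (simp add: quant_def diff_op_def)

lemma quant_eqI: "A \<in> extensional C_inf \<Longrightarrow> (\<And>f x. f \<in> C_inf \<Longrightarrow> A f x = quant a f x) \<Longrightarrow> A = quant a"
  by (rule ext) (metis extensional_arb quant_extensional ext)

lemma op_add_quant: "op_add (quant a) (quant b) = quant (a + b)"
  by (rule quant_eqI) (simp_all add: op_add_def quant_add_left)

lemma op_scale_quant: "op_scale c (quant a) = quant (c *\<^sub>R a)"
  by (rule quant_eqI) (simp_all add: op_scale_def quant_scaleR_left)

text \<open>\<open>diff_op\<close> and \<open>homogeneous\<close> accept coefficient families that
  are arbitrary above the degrees they read; cutting them off yields a total symbol.\<close>

lemma ex_sym_truncate: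
  assumes "\<And>\<alpha>. a \<alpha> \<in> C_inf"
  obtains p where "\<And>\<alpha>. mi_degree \<alpha> < n \<Longrightarrow> coef p \<alpha> = a \<alpha>" "deg_lt n p"
proof -
  let ?b = "\<lambda>\<alpha>. if mi_degree \<alpha> < n then a \<alpha> else (\<lambda>x. 0)"
  have "bounded_support ?b"
    unfolding bounded_support_def by (rule exI[of _ n]) simp
  then have "coef (Abs_sym ?b) = ?b"
    using assms by (intro Abs_sym_inverse) simp
  then show ?thesis
    by (intro that[of "Abs_sym ?b"]) (simp_all add: deg_lt_def)
qed

lemma diff_op_cong: "(\<And>\<alpha>. mi_degree \<alpha> \<le> k \<Longrightarrow> a \<alpha> = b \<alpha>) \<Longrightarrow> diff_op k a = diff_op k b"
  unfolding diff_op_def by (intro restrict_ext ext sum.cong) auto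

lemma homogeneous_cong:
  "(\<And>\<alpha>. mi_degree \<alpha> = k \<Longrightarrow> a \<alpha> = b \<alpha>) \<Longrightarrow> homogeneous k a = homogeneous k b"
  unfolding homogeneous_def by (intro ext sum.cong) auto

lemma diff_ops_le_eq: "(diff_ops_le k :: 'n::finite operator set) = quant ` {a. deg_lt (Suc k) a}"
proof (intro subset_antisym subsetI)
  fix A :: "'n operator"
  assume "A \<in> diff_ops_le k"
  then obtain a where a: "A = diff_op k a" "\<And>\<alpha>. a \<alpha> \<in> C_inf"
    by (auto simp: diff_ops_le_def)
  obtain p where p: "\<And>\<alpha>. mi_degree \<alpha> < Suc k \<Longrightarrow> coef p \<alpha> = a \<alpha>" "deg_lt (Suc k) p"
    using ex_sym_truncate a(2) by blast
  have "A = quant p"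
    unfolding a(1) quant_eq[OF p(2)] by (rule diff_op_cong) (simp add: p(1))
  then show "A \<in> quant ` {a. deg_lt (Suc k) a}"
    using p(2) by blast
next
  fix A :: "'n operator"
  assume "A \<in> quant ` {a. deg_lt (Suc k) a}"
  then show "A \<in> diff_ops_le k"
    unfolding diff_ops_le_def using quant_eq coef_C_inf by blast
qed

lemma range_quant: "range quant = diff_ops"
  unfolding diff_ops_def diff_ops_le_eq using ex_deg_lt_Suc by blast

text \<open>Injectivity of \<open>quant\<close> makes the description in \<open>symbol_map\<close>
  proper. A competing family is truncated first, since its coefficients above degree k are
  unconstrained.\<close>

lemma symbol_map_quant:
  assumes "deg_lt (Suc k) p"
  shows "symbol_map k (quant p) = homogeneous k (coef p)"
  unfolding symbol_map_def
proof (rule the_equality)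
  show "\<exists>a. (\<forall>\<alpha>. a \<alpha> \<in> C_inf) \<and> quant p = diff_op k a \<and> homogeneous k (coef p) = homogeneous k a"
    using quant_eq[OF assms] coef_C_inf by blast
  fix P
  assume "\<exists>a. (\<forall>\<alpha>. a \<alpha> \<in> C_inf) \<and> quant p = diff_op k a \<and> P = homogeneous k a"
  then obtain a where a: "\<And>\<alpha>. a \<alpha> \<in> C_inf" "quant p = diff_op k a" "P = homogeneous k a"
    by blast
  obtain q where q: "\<And>\<alpha>. mi_degree \<alpha> < Suc k \<Longrightarrow> coef q \<alpha> = a \<alpha>" "deg_lt (Suc k) q"
    using ex_sym_truncate a(1) by blast
  have "quant q = quant p"
    unfolding a(2) quant_eq[OF q(2)] by (rule diff_op_cong) (simp add: q(1))
  then have "q = p"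
    by (rule injD[OF inj_quant])
  then show "P = homogeneous k (coef p)"
    unfolding a(3) using q(1) by (intro homogeneous_cong) auto
qed

section \<open>Polynomials in the covector variable\<close>

lemma monomial_0 [simp]: "monomial (\<lambda>i. 0) \<xi> = 1"
  by (simp add: monomial_def)

lemma monomial_inc: "monomial (mi_inc i \<alpha>) \<xi> = \<xi> $ i * monomial \<alpha> \<xi>"
  unfolding monomial_def mi_inc_def by (simp add: prod.remove[of UNIV i])

lemma monomial_C_inf: "monomial \<alpha> \<in> C_inf"
proof (induction \<alpha> rule: mi_induct)
  case zero
  have "monomial (\<lambda>i. 0) = (\<lambda>\<xi> :: real^'a. 1)"
    by (simp add: fun_eq_iff)
  then show ?case by simp
next
  case (inc i \<alpha>)
  have "monomial (mi_inc i \<alpha>) = (\<lambda>\<xi>. \<xi> $ i * monomial \<alpha> \<xi>)"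
    by (simp add: monomial_inc fun_eq_iff)
  then show ?case
    using inc by (simp add: C_inf_mult)
qed

lemma pd_monomial: "pd j (monomial \<alpha>) = (\<lambda>\<xi>. real (\<alpha> j) * monomial (mi_dec j \<alpha>) \<xi>)"
proof (induction \<alpha> rule: mi_induct)
  case zero
  have "monomial (\<lambda>i. 0) = (\<lambda>\<xi> :: real^'a. 1)"
    by (simp add: fun_eq_iff)
  then show ?case by simp
next
  case (inc i \<alpha>)
  have "monomial (mi_inc i \<alpha>) = (\<lambda>\<xi>. \<xi> $ i * monomial \<alpha> \<xi>)"
    by (simp add: monomial_inc fun_eq_iff)
  then have "pd j (monomial (mi_inc i \<alpha>))
      = (\<lambda>\<xi>. (if j = i then 1 else 0) * monomial \<alpha> \<xi> + \<xi> $ i * (real (\<alpha> j) * monomial (mi_dec j \<alpha>) \<xi>))"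
    by (simp add: pd_mult_C_inf monomial_C_inf inc)
  also have "\<dots> = (\<lambda>\<xi>. real (mi_inc i \<alpha> j) * monomial (mi_dec j (mi_inc i \<alpha>)) \<xi>)"
  proof (cases "i = j \<or> \<alpha> j = 0")
    case True
    then show ?thesis
      by (cases "\<alpha> j = 0") (auto simp: mi_inc_apply algebra_simps monomial_inc[symmetric])
  next
    case False
    then show ?thesis
      by (auto simp: mi_inc_apply mi_inc_dec_commute[symmetric] monomial_inc fun_eq_iff)
  qed
  finally show ?case .
qed

lemma pd_homogeneous_covector:
  "pd j (homogeneous k b x) = (\<lambda>\<xi>. \<Sum>\<alpha> | mi_degree \<alpha> = k. b \<alpha> x * (real (\<alpha> j) * monomial (mi_dec j \<alpha>) \<xi>))"
proof -
  have "homogeneous k b x = (\<lambda>\<xi>. \<Sum>\<alpha> | mi_degree \<alpha> = k. b \<alpha> x * monomial \<alpha> \<xi>)"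
    by (simp add: homogeneous_def fun_eq_iff)
  then show ?thesis
    by (simp add: pd_sum_C_inf C_inf_cmult monomial_C_inf pd_cmult_C_inf pd_monomial)
qed

lemma pd_homogeneous_dxi:
  "pd j (homogeneous (Suc k) (coef a) x) \<xi> = homogeneous k (coef (dxi j a)) x \<xi>"
proof -
  have "pd j (homogeneous (Suc k) (coef a) x) \<xi> = (\<Sum>\<alpha> | mi_degree \<alpha> = Suc k.
      if \<alpha> j = 0 then 0 else coef (dxi j a) (mi_dec j \<alpha>) x * monomial (mi_dec j \<alpha>) \<xi>)"
    unfolding pd_homogeneous_covector by (rule sum.cong) (auto simp: mi_dec_apply)
  also have "\<dots> = (\<Sum>\<beta> | Suc (mi_degree \<beta>) = Suc k. coef (dxi j a) \<beta> x * monomial \<beta> \<xi>)"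
    by (rule sum_mi_dec_shift) (rule finite_mi_degree_eq)
  finally show ?thesis
    by (simp add: homogeneous_def)
qed

lemma homogeneous_mulxi:
  "homogeneous (Suc k) (coef (mulxi i a)) x \<xi> = \<xi> $ i * homogeneous k (coef a) x \<xi>"
proof -
  have "homogeneous (Suc k) (coef (mulxi i a)) x \<xi> = (\<Sum>\<alpha> | mi_degree \<alpha> = Suc k.
      if \<alpha> i = 0 then 0 else coef a (mi_dec i \<alpha>) x * monomial (mi_inc i (mi_dec i \<alpha>)) \<xi>)"
    unfolding homogeneous_def by (rule sum.cong) auto
  also have "\<dots> = (\<Sum>\<beta> | Suc (mi_degree \<beta>) = Suc k. coef a \<beta> x * monomial (mi_inc i \<beta>) \<xi>)"
    by (rule sum_mi_dec_shift) (rule finite_mi_degree_eq)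
  finally show ?thesis
    by (simp add: homogeneous_def monomial_inc sum_distrib_left mult_ac)
qed

text \<open>This is the combination occurring in \<open>rho\<close>, and it preserves the degree.
  Degree 0 is separate because there the derivative vanishes instead of lowering the degree.\<close>

lemma homogeneous_mulxi_dxi:
  "homogeneous k (coef (mulxi i (dxi j a))) x \<xi> = \<xi> $ i * pd j (homogeneous k (coef a) x) \<xi>"
proof (cases k)
  case 0
  have "{\<alpha> :: 'a \<Rightarrow> nat. mi_degree \<alpha> = 0} = {\<lambda>i. 0}"
    by auto
  then show ?thesis
    by (simp add: 0 pd_homogeneous_covector) (simp add: homogeneous_def)
next
  case (Suc l)
  then show ?thesis
    by (simp add: pd_homogeneous_dxi homogeneous_mulxi)
qed

definition tens :: "'n::finite sym \<Rightarrow> nat \<Rightarrow> 'n tensor_field"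
  where "tens a k = homogeneous k (coef a)"

lemma tens_add: "tens (a + b) k x \<xi> = tens a k x \<xi> + tens b k x \<xi>"
  and tens_scaleR: "tens (c *\<^sub>R a) k x \<xi> = c * tens a k x \<xi>"
  and tens_diff: "tens (a - b) k x \<xi> = tens a k x \<xi> - tens b k x \<xi>"
  and tens_mulx: "tens (mulx i a) k x \<xi> = x $ i * tens a k x \<xi>"
  by (simp_all add: tens_def homogeneous_def sum.distrib sum_subtractf sum_distrib_left algebra_simps)

lemma tens_zero [simp]: "tens 0 k x \<xi> = 0"
  by (simp add: tens_def homogeneous_def)

lemma tens_sum: "tens (\<Sum>i\<in>I. a i) k x \<xi> = (\<Sum>i\<in>I. tens (a i) k x \<xi>)"
  by (induction I rule: infinite_finite_induct) (simp_all add: tens_add)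

lemma tens_dx: "pd i (\<lambda>y. tens a k y \<xi>) x = tens (dx i a) k x \<xi>"
proof -
  have "(\<lambda>y. tens a k y \<xi>) = (\<lambda>y. \<Sum>\<alpha> | mi_degree \<alpha> = k. monomial \<alpha> \<xi> * coef a \<alpha> y)"
    by (simp add: tens_def homogeneous_def mult.commute fun_eq_iff)
  then show ?thesis
    by (simp add: pd_sum_C_inf C_inf_cmult pd_cmult_C_inf)
      (simp add: tens_def homogeneous_def coef_dx mult.commute)
qed

lemma tens_mulxi_dxi: "\<xi> $ i * pd j (tens a k x) \<xi> = tens (mulxi i (dxi j a)) k x \<xi>"
  by (simp add: tens_def homogeneous_mulxi_dxi)

text \<open>Differentiating in \<xi> reduces the degree until a constant remains, which replaces an
  argument on linear independence of monomials.\<close>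

lemma tens_comp_kernel:
  assumes "tens a k = (\<lambda>x \<xi>. 0)" "mi_degree \<alpha> = k"
  shows "coef a \<alpha> x = 0"
  using assms
proof (induction k arbitrary: a \<alpha>)
  case 0
  have z: "{\<alpha> :: 'a \<Rightarrow> nat. mi_degree \<alpha> = 0} = {\<lambda>i. 0}"
    by auto
  have "tens a 0 x 0 = coef a (\<lambda>i. 0) x"
    unfolding tens_def homogeneous_def z by simp
  then show ?case
    using 0 by simp
next
  case (Suc k)
  have "tens (dxi i a) k x \<xi> = 0" for i x \<xi>
    using Suc.prems(1) unfolding tens_def by (simp add: pd_homogeneous_dxi[symmetric])
  then have *: "tens (dxi i a) k = (\<lambda>x \<xi>. 0)" for i
    by (simp add: fun_eq_iff)
  obtain i \<beta> where \<alpha>: "\<alpha> = mi_inc i \<beta>"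
    using Suc.prems(2) mi_neq_0_of_degree_Suc mi_neq_0E by metis
  have "coef (dxi i a) \<beta> x = 0"
    using Suc.prems(2) by (intro Suc.IH *) (simp add: \<alpha>)
  then show ?case
    by (simp add: \<alpha>)
qed

lemma inj_tens: "inj (tens :: 'n::finite sym \<Rightarrow> _)"
proof (rule injI)
  fix a b :: "'n sym"
  assume "tens a = tens b"
  then have "tens (a - b) k = (\<lambda>x \<xi>. 0)" for k
    by (simp add: fun_eq_iff tens_diff)
  then have "coef (a - b) \<alpha> x = 0" for \<alpha> x
    using tens_comp_kernel by blast
  then show "a = b"
    by (intro sym_eqI) simp
qed

lemma tens_eq_0:
  assumes "deg_lt n a" "n \<le> k"
  shows "tens a k = (\<lambda>x \<xi>. 0)"
  using assms by (simp add: tens_def homogeneous_def deg_lt_iff fun_eq_iff)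

lemma range_tens: "range tens = (symbol_space :: (nat \<Rightarrow> 'n::finite tensor_field) set)"
proof (intro subset_antisym subsetI)
  fix S :: "nat \<Rightarrow> 'n tensor_field"
  assume "S \<in> range tens"
  then obtain a where a: "S = tens a"
    by blast
  obtain n where "deg_lt n a"
    using ex_deg_lt by blast
  then have "{k. S k \<noteq> (\<lambda>x \<xi>. 0)} \<subseteq> {..<n}"
    unfolding a using tens_eq_0 not_le by blast
  then have "finite {k. S k \<noteq> (\<lambda>x \<xi>. 0)}"
    using finite_subset by blast
  moreover have "S k \<in> symbols_deg k" for k
    unfolding a tens_def symbols_deg_def using coef_C_inf by blast
  ultimately show "S \<in> symbol_space"
    by (simp add: symbol_space_def)
next
  fix S :: "nat \<Rightarrow> 'n tensor_field"
  assume S: "S \<in> symbol_space"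
  then have "\<forall>k. \<exists>a. S k = homogeneous k a \<and> (\<forall>\<alpha>. a \<alpha> \<in> C_inf)"
    by (auto simp: symbol_space_def symbols_deg_def)
  then obtain b where b: "\<And>k. S k = homogeneous k (b k)" "\<And>k \<alpha>. b k \<alpha> \<in> C_inf"
    by metis
  obtain n where n: "\<And>k. S k \<noteq> (\<lambda>x \<xi>. 0) \<Longrightarrow> k < n"
    using S finite_nat_bounded[of "{k. S k \<noteq> (\<lambda>x \<xi>. 0)}"] by (auto simp: symbol_space_def)
  \<comment> \<open>Each component of \<open>S\<close> comes with its own coefficient family; the
    degree of \<alpha> decides which one supplies the coefficient at \<alpha>.\<close>
  obtain p where p: "\<And>\<alpha>. mi_degree \<alpha> < n \<Longrightarrow> coef p \<alpha> = b (mi_degree \<alpha>) \<alpha>" "deg_lt n p"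
    using ex_sym_truncate[of "\<lambda>\<alpha>. b (mi_degree \<alpha>) \<alpha>"] b(2) by blast
  have "tens p k = S k" for k
  proof (cases "k < n")
    case True
    then show ?thesis
      unfolding b(1) tens_def by (intro homogeneous_cong) (simp add: p(1))
  next
    case False
    then show ?thesis
      using tens_eq_0[OF p(2), of k] n[of k] by (metis not_le)
  qed
  then have "S = tens p"
    by (simp add: fun_eq_iff)
  then show "S \<in> range tens"
    by blast
qed

section \<open>The projective vector fields\<close>

definition sl_field :: "('n::finite \<Rightarrow> real) \<Rightarrow> ('n \<Rightarrow> 'n \<Rightarrow> real) \<Rightarrow> ('n \<Rightarrow> real) \<Rightarrow> 'n vec_field"
  where "sl_field u v w x = (\<Sum>i\<in>UNIV. u i *\<^sub>R const_field i x)
    + (\<Sum>j\<in>UNIV. \<Sum>i\<in>UNIV. v j i *\<^sub>R linear_field j i x)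
    + (\<Sum>j\<in>UNIV. w j *\<^sub>R quadratic_field j x)"

lemma ball_sl_iff: "(\<forall>X\<in>sl. P X) \<longleftrightarrow> (\<forall>u v w. P (sl_field u v w))"
  by (auto simp: sl_def sl_field_def[abs_def])

lemma sl_field_component:
  "sl_field u v w x $ i = u i + (\<Sum>j\<in>UNIV. v j i * x $ j) + (\<Sum>j\<in>UNIV. w j * x $ j) * x $ i"
proof -
  have ax: "axis l (1::real) $ i = (if l = i then 1 else 0)" for l :: 'a
    by (simp add: axis_def)
  have e: "euler_field x $ i = x $ i"
    by (simp add: euler_field_def const_field_def ax if_distrib[of "(*) _"] cong: if_cong)
  have "(\<Sum>l\<in>UNIV. u l *\<^sub>R const_field l x) $ i = u i"
    by (simp add: const_field_def ax if_distrib[of "(*) _"] cong: if_cong)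
  moreover have "(\<Sum>j\<in>UNIV. \<Sum>l\<in>UNIV. v j l *\<^sub>R linear_field j l x) $ i = (\<Sum>j\<in>UNIV. v j i * x $ j)"
    by (simp add: linear_field_def const_field_def ax if_distrib[of "(*) _"] cong: if_cong)
  moreover have "(\<Sum>j\<in>UNIV. w j *\<^sub>R quadratic_field j x) $ i = (\<Sum>j\<in>UNIV. w j * x $ j) * x $ i"
    by (simp add: quadratic_field_def e sum_distrib_right mult.assoc)
  ultimately show ?thesis
    by (simp add: sl_field_def)
qed

lemma DX_sl_field:
  "DX (sl_field u v w) x $ i $ l
    = v l i + w l * x $ i + (if l = i then \<Sum>j\<in>UNIV. w j * x $ j else 0)"
proof -
  have "(\<lambda>y. sl_field u v w y $ i)
      = (\<lambda>y. (u i + (\<Sum>j\<in>UNIV. v j i * y $ j)) + (\<Sum>j\<in>UNIV. w j * y $ j) * y $ i)"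
    by (simp add: sl_field_component)
  then have "pd l (\<lambda>y. sl_field u v w y $ i) x
      = (\<Sum>j\<in>UNIV. v j i * (if l = j then 1 else 0))
      + ((\<Sum>j\<in>UNIV. w j * (if l = j then 1 else 0)) * x $ i
      + (\<Sum>j\<in>UNIV. w j * x $ j) * (if l = i then 1 else 0))"
    by (simp only: pd_add_C_inf pd_mult_C_inf pd_sum_C_inf pd_cmult_C_inf C_inf_add C_inf_mult C_inf_sum
        C_inf_cmult C_inf_component C_inf_const pd_component pd_const add_0_left
        mult_zero_left)
  then show ?thesis
    by (simp add: DX_def if_distrib[of "(*) _"] cong: if_cong)
qed

text \<open>The scalar part of \<open>DX\<close> contributes m times the linear form given by
  \<open>w\<close>, the rank-one part once more; hence the m + 1 in \<theta> and in lam (m +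
  1).\<close>

lemma trace_DX_sl_field:
  fixes u :: "'n::finite \<Rightarrow> real"
  shows "trace (DX (sl_field u v w) x)
    = (\<Sum>i\<in>UNIV. v i i) + (real CARD('n) + 1) * (\<Sum>j\<in>UNIV. w j * x $ j)"
  by (simp add: trace_def DX_sl_field sum.distrib algebra_simps)

lemma dir_deriv_sl_field:
  "dir_deriv (sl_field u v w) f x = (\<Sum>i\<in>UNIV. u i * pd i f x)
    + (\<Sum>j\<in>UNIV. \<Sum>i\<in>UNIV. v j i * (x $ j * pd i f x))
    + (\<Sum>j\<in>UNIV. w j * (x $ j * (\<Sum>i\<in>UNIV. x $ i * pd i f x)))"
proof -
  have "(\<Sum>i\<in>UNIV. (\<Sum>j\<in>UNIV. v j i * x $ j) * pd i f x) = (\<Sum>j\<in>UNIV. \<Sum>i\<in>UNIV. v j i * (x $ j * pd i f x))"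
    unfolding sum_distrib_right by (subst sum.swap) (simp add: mult.assoc)
  moreover have "(\<Sum>i\<in>UNIV. (\<Sum>j\<in>UNIV. w j * x $ j) * x $ i * pd i f x)
      = (\<Sum>j\<in>UNIV. w j * (x $ j * (\<Sum>i\<in>UNIV. x $ i * pd i f x)))"
    unfolding mult.assoc sum_distrib_left[symmetric] by (simp add: sum_distrib_right mult.assoc)
  ultimately show ?thesis
    by (simp add: dir_deriv_def sl_field_component distrib_right sum.distrib)
qed

lemma sum_sum_diag:
  "(\<Sum>j\<in>UNIV. \<Sum>i\<in>UNIV. v j i * (if i = j then c else 0)) = (\<Sum>i\<in>UNIV. v i (i::'n::finite)) * (c::real)"
proof -
  have "(\<Sum>i\<in>UNIV. v j i * (if i = j then c else 0)) = v j j * c" for j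
    by (simp add: if_distrib[of "(*) _"] cong: if_cong)
  then show ?thesis
    by (simp add: sum_distrib_right)
qed

lemma lie_density_sl_field:
  fixes f :: "'n::finite scalar_fn"
  shows "lie_density lam (sl_field u v w) f x = (\<Sum>i\<in>UNIV. u i * pd i f x)
    + (\<Sum>j\<in>UNIV. \<Sum>i\<in>UNIV. v j i * (x $ j * pd i f x + (if i = j then lam * f x else 0)))
    + (\<Sum>j\<in>UNIV. w j * (x $ j * (\<Sum>i\<in>UNIV. x $ i * pd i f x) + lam * (real CARD('n) + 1) * (x $ j * f x)))"
proof -
  have "(\<Sum>j\<in>UNIV. w j * (lam * (real CARD('n) + 1) * (x $ j * f x)))
      = lam * (real CARD('n) + 1) * (\<Sum>j\<in>UNIV. w j * x $ j) * f x"
    by (simp add: sum_distrib_left sum_distrib_right mult_ac)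
  then show ?thesis
    by (simp add: lie_density_def dir_deriv_sl_field trace_DX_sl_field distrib_left distrib_right sum.distrib
        sum_sum_diag)
qed

lemma quant_euler:
  assumes f: "f \<in> C_inf"
  shows "quant a (\<lambda>y. \<Sum>i\<in>UNIV. y $ i * pd i f y) x
    = (\<Sum>i\<in>UNIV. x $ i * quant a (pd i f) x) + quant (wt real a) f x"
proof -
  have "quant a (\<lambda>y. \<Sum>i\<in>UNIV. y $ i * pd i f y) x = (\<Sum>i\<in>UNIV. quant a (\<lambda>y. y $ i * pd i f y) x)"
    by (intro quant_sum_right C_inf_mult C_inf_component C_inf_pd f)
  also have "\<dots> = (\<Sum>i\<in>UNIV. x $ i * quant a (pd i f) x + quant (mulxi i (dxi i a)) f x)"
    by (simp add: quant_dxi C_inf_pd f quant_mulxi)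
  finally show ?thesis
    by (simp add: sum.distrib flip: quant_sum_left[OF f] sum_mulxi_dxi)
qed

text \<open>Moving both coordinates of x_j x_i to the left produces, besides single commutators, the
  double commutator \<open>wt real (dxi j a)\<close>. It is the part of the discrepancy that does
  not involve lam.\<close>

lemma quant_mulx_euler:
  assumes f: "f \<in> C_inf"
  shows "quant a (\<lambda>y. y $ j * (\<Sum>i\<in>UNIV. y $ i * pd i f y)) x
    = x $ j * (\<Sum>i\<in>UNIV. x $ i * quant a (pd i f) x) + x $ j * quant (wt real a) f x
      + quant (x_dot_xi (dxi j a)) f x + quant (wt real (dxi j a)) f x"
proof -
  have "(\<lambda>y. \<Sum>i\<in>UNIV. y $ i * pd i f y) \<in> C_inf"
    by (intro C_inf_sum C_inf_mult C_inf_component C_inf_pd f)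
  then show ?thesis
    by (simp add: quant_dxi quant_euler f x_dot_xi_def quant_sum_left quant_mulx quant_mulxi algebra_simps)
qed

lemma lie_op_quant:
  fixes a :: "'n::finite sym"
  assumes "\<delta> = mu - lam"
  shows "lie_op lam mu (sl_field u v w) (quant a) = quant (operator_action \<delta> (lam * (real CARD('n) + 1)) u v w a)"
proof (rule quant_eqI)
  show "lie_op lam mu (sl_field u v w) (quant a) \<in> extensional C_inf"
    by (simp add: lie_op_def)
  fix f :: "'n scalar_fn" and x
  assume f: "f \<in> C_inf"
  let ?c = "lam * (real CARD('n) + 1)"
  note fs = f C_inf_pd[OF f] C_inf_mult[OF C_inf_component f] C_inf_mult[OF C_inf_component C_inf_pd[OF f]]
  have fs': "(\<lambda>y. if i = j then lam * f y else 0) \<in> C_inf" for i j :: 'n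
    by (cases "i = j") (auto intro: C_inf_cmult f)
  have fe: "(\<lambda>y. y $ j * (\<Sum>i\<in>UNIV. y $ i * pd i f y)) \<in> C_inf" for j
    by (intro C_inf_sum C_inf_mult C_inf_component fs)
  have if_quant: "quant a (\<lambda>y. if i = j then lam * f y else 0) x = (if i = j then lam * quant a f x else 0)" for i j :: 'n
    using quant_cmult_right[OF f, of a lam x] quant_cmult_right[OF f, of a 0 x] by simp
  have "lie_density lam (sl_field u v w) f = (\<lambda>x. ((\<Sum>i\<in>UNIV. u i * pd i f x)
    + (\<Sum>j\<in>UNIV. \<Sum>i\<in>UNIV. v j i * (x $ j * pd i f x + (if i = j then lam * f x else 0))))
    + (\<Sum>j\<in>UNIV. w j * (x $ j * (\<Sum>i\<in>UNIV. x $ i * pd i f x) + ?c * (x $ j * f x))))"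
    by (rule ext, rule lie_density_sl_field)
  then have R: "quant a (lie_density lam (sl_field u v w) f) x = (\<Sum>i\<in>UNIV. u i * quant a (pd i f) x)
    + (\<Sum>j\<in>UNIV. \<Sum>i\<in>UNIV. v j i * (quant a (\<lambda>x. x $ j * pd i f x) x + (if i = j then lam * quant a f x else 0)))
    + (\<Sum>j\<in>UNIV. w j * (quant a (\<lambda>x. x $ j * (\<Sum>i\<in>UNIV. x $ i * pd i f x)) x + ?c * quant a (\<lambda>x. x $ j * f x) x))"
    by (simp only: quant_add_right quant_sum_right quant_cmult_right if_quant fs fs' fe C_inf_add C_inf_sum C_inf_cmult)
  have 2: "x $ j * pd i (quant a f) x + (if i = j then mu * quant a f x else 0)
      - (quant a (\<lambda>x. x $ j * pd i f x) x + (if i = j then lam * quant a f x else 0))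
    = quant (gl_gen j i a) f x + (if i = j then \<delta> else 0) * quant a f x" for i j
    by (simp add: gl_gen_def quant_diff_left f quant_mulx quant_mulxi quant_dxi C_inf_pd quant_dx assms
        algebra_simps)
  \<comment> \<open>\<open>quant_mulx_euler\<close> supplies the summand \<open>real l\<close> of
    the weight; the summand \<open>?c\<close> arises from moving x_j in the density term past the
    operator.\<close>
  have 3: "x $ j * (\<Sum>i\<in>UNIV. x $ i * pd i (quant a f) x) + mu * (real CARD('n) + 1) * (x $ j * quant a f x)
      - (quant a (\<lambda>x. x $ j * (\<Sum>i\<in>UNIV. x $ i * pd i f x)) x + ?c * quant a (\<lambda>x. x $ j * f x) x)
    = quant (quad_gen \<delta> j a - wt (\<lambda>l. real l + ?c) (dxi j a)) f x" for j
  proof -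
    have w: "wt (\<lambda>l. real l + ?c) (dxi j a) = wt real (dxi j a) + ?c *\<^sub>R dxi j a"
      using wt_affine[of 1 ?c] by simp
    show ?thesis
      unfolding w quad_gen_def euler_def
      by (simp add: quant_add_left quant_diff_left quant_scaleR_left quant_sum_left f quant_mulx quant_mulx_euler quant_dxi quant_dx
          distrib_left sum.distrib assms) (simp add: algebra_simps)
  qed
  show "lie_op lam mu (sl_field u v w) (quant a) f x = quant (operator_action \<delta> ?c u v w a) f x"
    unfolding operator_action_eq
    by (simp only: quant_add_left[OF f] quant_sum_left[OF f] quant_scaleR_left[OF f] 2[symmetric] 3[symmetric])
      (simp add: lie_op_def f lie_density_sl_field[of mu] R quant_dx[OF f] right_diff_distrib distrib_left
        sum.distrib sum_subtractf)
qed

lemma lie_tensor_tens: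
  fixes a :: "'n::finite sym"
  shows "lie_tensor \<delta> (sl_field u v w) (tens a k) = tens (symbol_action \<delta> u v w a) k"
proof (intro ext)
  fix x \<xi> :: "real^'n"
  have "rho (DX (sl_field u v w) x) (tens a k x) \<xi>
      = (\<Sum>i\<in>UNIV. \<Sum>l\<in>UNIV. (v l i + w l * x $ i + (if l = i then \<Sum>j\<in>UNIV. w j * x $ j else 0))
          * tens (mulxi i (dxi l a)) k x \<xi>)"
    by (simp add: rho_def DX_sl_field mult.assoc tens_mulxi_dxi)
  \<comment> \<open>The Jacobian splits into a constant matrix, a rank-one matrix and a multiple of
    the identity. They give the \<xi>-part of \<open>gl_gen\<close>, the term in
    \<open>x_dot_xi\<close> and the degree term of \<open>quad_gen\<close>.\<close>
  also have "\<dots> = (\<Sum>i\<in>UNIV. \<Sum>l\<in>UNIV. v l i * tens (mulxi i (dxi l a)) k x \<xi>)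
      + (\<Sum>i\<in>UNIV. \<Sum>l\<in>UNIV. w l * (x $ i * tens (mulxi i (dxi l a)) k x \<xi>))
      + (\<Sum>i\<in>UNIV. \<Sum>l\<in>UNIV. if l = i then (\<Sum>j\<in>UNIV. w j * x $ j) * tens (mulxi i (dxi l a)) k x \<xi> else 0)"
    unfolding sum.distrib[symmetric] by (intro sum.cong) (auto simp: algebra_simps)
  also have "(\<Sum>i\<in>UNIV. \<Sum>l\<in>UNIV. if l = i then (\<Sum>j\<in>UNIV. w j * x $ j) * tens (mulxi i (dxi l a)) k x \<xi> else 0)
      = (\<Sum>j\<in>UNIV. w j * x $ j) * tens (wt real a) k x \<xi>"
    by (simp add: sum_mulxi_dxi[symmetric] tens_sum flip: sum_distrib_left)
  also have "(\<Sum>i\<in>UNIV. \<Sum>l\<in>UNIV. w l * (x $ i * tens (mulxi i (dxi l a)) k x \<xi>))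
      = (\<Sum>l\<in>UNIV. w l * tens (x_dot_xi (dxi l a)) k x \<xi>)"
    by (subst sum.swap) (simp add: x_dot_xi_def tens_sum tens_mulx sum_distrib_left)
  also have "(\<Sum>i\<in>UNIV. \<Sum>l\<in>UNIV. v l i * tens (mulxi i (dxi l a)) k x \<xi>)
      = (\<Sum>l\<in>UNIV. \<Sum>i\<in>UNIV. v l i * tens (mulxi i (dxi l a)) k x \<xi>)"
    by (rule sum.swap)
  finally have rho: "rho (DX (sl_field u v w) x) (tens a k x) \<xi>
    = (\<Sum>l\<in>UNIV. \<Sum>i\<in>UNIV. v l i * tens (mulxi i (dxi l a)) k x \<xi>)
      + (\<Sum>l\<in>UNIV. w l * tens (x_dot_xi (dxi l a)) k x \<xi>)
      + (\<Sum>l\<in>UNIV. w l * tens (mulx l (wt real a)) k x \<xi>)"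
    by (simp add: tens_mulx sum_distrib_right mult.assoc)
  have 2: "v j i * (tens (gl_gen j i a) k x \<xi> + (if i = j then \<delta> else 0) * tens a k x \<xi>)
    = v j i * (x $ j * tens (dx i a) k x \<xi>) - v j i * tens (mulxi i (dxi j a)) k x \<xi>
      + v j i * (if i = j then \<delta> * tens a k x \<xi> else 0)" for i j
    by (simp add: gl_gen_def tens_add tens_diff tens_scaleR tens_mulx algebra_simps)
  have 3: "w j * tens (quad_gen \<delta> j a) k x \<xi>
    = w j * (x $ j * (\<Sum>i\<in>UNIV. x $ i * tens (dx i a) k x \<xi>)) - w j * tens (x_dot_xi (dxi j a)) k x \<xi>
      - w j * tens (mulx j (wt real a)) k x \<xi>
      + w j * x $ j * (\<delta> * (real CARD('n) + 1) * tens a k x \<xi>)" for j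
    by (simp add: quad_gen_def euler_def tens_add tens_diff tens_scaleR tens_mulx tens_sum algebra_simps)
  show "lie_tensor \<delta> (sl_field u v w) (tens a k) x \<xi> = tens (symbol_action \<delta> u v w a) k x \<xi>"
    unfolding lie_tensor_def dir_deriv_sl_field rho trace_DX_sl_field symbol_action_def tens_add tens_sum tens_scaleR
      2 3 sum.distrib sum_subtractf tens_dx sum_sum_diag sum_distrib_right[symmetric]
    by (simp add: algebra_simps)
qed

text \<open>The prescribed leading term, read on total symbols, is unitriangularity for the degree
  filtration.\<close>

lemma symbol_condition_iff:
  fixes T :: "'n::finite sym \<Rightarrow> 'n sym"
  shows "(\<forall>k a. deg_lt (Suc k) a \<longrightarrow> (\<forall>l>k. tens (T a) l = (\<lambda>x \<xi>. 0)) \<and> tens (T a) k = tens a k)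
    \<longleftrightarrow> (\<forall>n a. deg_lt (Suc n) a \<longrightarrow> deg_lt n (T a - a))"
proof (intro iffI allI impI conjI)
  fix k l and a :: "'n sym"
  assume tri: "\<forall>n a. deg_lt (Suc n) a \<longrightarrow> deg_lt n (T a - a)" and a: "deg_lt (Suc k) a"
  then have d: "deg_lt k (T a - a)"
    by blast
  have eq: "tens (T a) l x \<xi> = tens a l x \<xi>" if "k \<le> l" for l x \<xi>
    using tens_eq_0[OF d that] tens_diff[of "T a" a l x \<xi>] by simp
  then show "tens (T a) k = tens a k"
    by (simp add: fun_eq_iff)
  show "tens (T a) l = (\<lambda>x \<xi>. 0)" if "k < l"
    using eq[of l] tens_eq_0[OF a, of l] that by (simp add: fun_eq_iff)
next
  fix n and a :: "'n sym"
  assume s: "\<forall>k a. deg_lt (Suc k) a \<longrightarrow> (\<forall>l>k. tens (T a) l = (\<lambda>x \<xi>. 0)) \<and> tens (T a) k = tens a k"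
    and a: "deg_lt (Suc n) a"
  have "tens (T a - a) l = (\<lambda>x \<xi>. 0)" if "n \<le> l" for l
  proof (cases "l = n")
    case True
    then show ?thesis
      using s a by (simp add: fun_eq_iff tens_diff)
  next
    case False
    then show ?thesis
      using s a that tens_eq_0[OF a, of l] by (simp add: fun_eq_iff tens_diff)
  qed
  then show "deg_lt n (T a - a)"
    unfolding deg_lt_iff using tens_comp_kernel by blast
qed

theorem corollary8p6:
  fixes lam mu \<delta> :: real
  assumes "\<delta> = mu - lam"
    and "(real CARD('n) + 1) * \<delta> - real CARD('n) \<notin> {real j | j :: nat. j \<ge> 1}"
  shows "\<exists>!\<sigma> :: ('n::finite) operator \<Rightarrow> nat \<Rightarrow> 'n tensor_field.
    \<sigma> \<in> diff_ops \<rightarrow>\<^sub>E symbol_space \<and>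
    linear_on_ops \<sigma> \<and>
    bij_betw \<sigma> diff_ops symbol_space \<and>
    sl_equivariant lam mu \<delta> \<sigma> \<and>
    (\<forall>k. \<forall>A\<in>diff_ops_le k. (\<forall>l>k. \<sigma> A l = (\<lambda>x \<xi>. 0)) \<and> \<sigma> A k = symbol_map k A)"
    (is "\<exists>!\<sigma>. ?P \<sigma>")
proof -
  define \<theta> where "\<theta> = (real CARD('n) + 1) * \<delta> - real CARD('n)"
  define c where "c = lam * (real CARD('n) + 1)"
  have \<theta>: "\<theta> \<notin> {real j | j :: nat. j \<ge> 1}"
    using assms(2) by (simp add: \<theta>_def)
  let ?S = "proj_symbol \<theta> c :: 'n sym \<Rightarrow> 'n sym"
  \<comment> \<open>The values of \<sigma> lie in the range of \<open>tens\<close>, so conjugation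
    turns \<sigma> into a self-map of the total symbols, so far without any structure.\<close>
  have conj: "\<exists>T. \<forall>a. tens (T a) = \<sigma> (quant a)" if "\<sigma> \<in> diff_ops \<rightarrow>\<^sub>E symbol_space"
    for \<sigma> :: "'n operator \<Rightarrow> nat \<Rightarrow> 'n tensor_field"
  proof (intro choice allI)
    fix a :: "'n sym"
    have "\<sigma> (quant a) \<in> range tens"
      using that unfolding range_tens range_quant[symmetric] by blast
    then show "\<exists>b. tens b = \<sigma> (quant a)"
      by force
  qed
  \<comment> \<open>\<open>quant\<close> and \<open>tens\<close> are bijections onto the two spaces,
    so each clause becomes a condition on \<open>T\<close> alone, and both halves of the claim
    reduce to statements about total symbols.\<close>
  have P_iff: "?P \<sigma> \<longleftrightarrow> linear T \<and> bij T \<and> (\<forall>u v w a. T (operator_action \<delta> c u v w a) = symbol_action \<delta> u v w (T a))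
      \<and> (\<forall>n a. deg_lt (Suc n) a \<longrightarrow> deg_lt n (T a - a))"
    if \<sigma>: "\<sigma> \<in> diff_ops \<rightarrow>\<^sub>E symbol_space" and T: "\<And>a. \<sigma> (quant a) = tens (T a)"
    for \<sigma> :: "'n operator \<Rightarrow> nat \<Rightarrow> 'n tensor_field" and T
  proof -
    have lin: "linear_on_ops \<sigma> \<longleftrightarrow> linear T"
    proof -
      have 1: "tens (T (a + b)) = (\<lambda>k x \<xi>. tens (T a) k x \<xi> + tens (T b) k x \<xi>) \<longleftrightarrow> T (a + b) = T a + T b" for a b
        unfolding inj_eq[OF inj_tens, symmetric] by (simp add: fun_eq_iff tens_add)
      have 2: "tens (T (r *\<^sub>R a)) = (\<lambda>k x \<xi>. r * tens (T a) k x \<xi>) \<longleftrightarrow> T (r *\<^sub>R a) = r *\<^sub>R T a" for r a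
        unfolding inj_eq[OF inj_tens, symmetric] by (simp add: fun_eq_iff tens_scaleR)
      show ?thesis
        unfolding linear_on_ops_def range_quant[symmetric] linear_iff
        by (simp add: op_add_quant op_scale_quant T 1 2)
    qed
    have bij: "bij_betw \<sigma> diff_ops symbol_space \<longleftrightarrow> bij T"
    proof -
      have "bij_betw \<sigma> diff_ops symbol_space \<longleftrightarrow> bij_betw (\<sigma> \<circ> quant) UNIV symbol_space"
        by (rule bij_betw_comp_iff) (simp add: bij_betw_def inj_quant range_quant)
      also have "\<sigma> \<circ> quant = tens \<circ> T"
        by (simp add: fun_eq_iff T)
      also have "bij_betw (tens \<circ> T) UNIV symbol_space \<longleftrightarrow> bij T"
        by (rule bij_betw_comp_iff2[symmetric]) (simp_all add: bij_betw_def inj_tens range_tens)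
      finally show ?thesis .
    qed
    have eqv: "sl_equivariant lam mu \<delta> \<sigma> \<longleftrightarrow> (\<forall>u v w a. T (operator_action \<delta> c u v w a) = symbol_action \<delta> u v w (T a))"
    proof -
      have "lie_symbol \<delta> (sl_field u v w) (tens (T a)) = tens (symbol_action \<delta> u v w (T a))" for u v w a
        by (simp add: lie_symbol_def[abs_def] lie_tensor_tens)
      then show ?thesis
        unfolding sl_equivariant_def range_quant[symmetric] ball_sl_iff
        by (auto simp: lie_op_quant[OF assms(1)] T c_def inj_eq[OF inj_tens])
    qed
    have sym: "(\<forall>k. \<forall>A\<in>diff_ops_le k. (\<forall>l>k. \<sigma> A l = (\<lambda>x \<xi>. 0)) \<and> \<sigma> A k = symbol_map k A)
      \<longleftrightarrow> (\<forall>n a. deg_lt (Suc n) a \<longrightarrow> deg_lt n (T a - a))"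
      unfolding symbol_condition_iff[symmetric] diff_ops_le_eq
      by (auto simp: T symbol_map_quant tens_def[of _ _, symmetric])
    show ?thesis
      using \<sigma> lin bij eqv sym by blast
  qed
  define \<sigma>0 where "\<sigma>0 = (\<lambda>A\<in>diff_ops. tens (?S (inv quant A)))"
  have \<sigma>0: "\<sigma>0 (quant a) = tens (?S a)" for a
  proof -
    have "quant a \<in> diff_ops"
      using range_quant by blast
    then show ?thesis
      by (simp add: \<sigma>0_def inv_f_f[OF inj_quant])
  qed
  have \<sigma>0_space: "\<sigma>0 \<in> diff_ops \<rightarrow>\<^sub>E symbol_space"
    unfolding \<sigma>0_def range_tens[symmetric] by auto
  show ?thesis
  proof (rule ex1I)
    have "bij ?S"
      by (rule unitriangular_bij[OF linear_proj_symbol proj_symbol_triangular])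
    then show "?P \<sigma>0"
      unfolding P_iff[OF \<sigma>0_space \<sigma>0]
      by (simp add: linear_proj_symbol proj_symbol_triangular proj_symbol_operator_action[OF \<theta>_def \<theta>])
  next
    fix \<sigma>
    assume P: "?P \<sigma>"
    then have \<sigma>: "\<sigma> \<in> diff_ops \<rightarrow>\<^sub>E symbol_space"
      by blast
    obtain T where T: "\<And>a. \<sigma> (quant a) = tens (T a)"
      using conj[OF \<sigma>] by metis
    have "T = ?S"
      by (rule equivariant_symbol_unique[OF \<theta>_def \<theta>]) (use P in \<open>simp_all only: P_iff[OF \<sigma> T]\<close>)
    then have "\<sigma> (quant a) = \<sigma>0 (quant a)" for a
      by (simp add: T \<sigma>0)
    \<comment> \<open>\<open>quant\<close> reaches every operator in \<open>diff_ops\<close>;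
      elsewhere both maps are \<open>undefined\<close>.\<close>
    then show "\<sigma> = \<sigma>0"
      using \<sigma> \<sigma>0_space unfolding range_quant[symmetric] by (intro PiE_ext) auto
  qed
qed

end
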